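(* Let $T_1$ and $T_2$ be trees with orders $m$ and $n$ and diameters $d_1\ge 2$ and $d_2\ge 2$, let $G=T_1\Box T_2$, $p=mn$, $d=d_1+d_2$ and $\xi=|W(T_1)|+|W(T_2)|-2$. Then ${\rm rn}(G)$ equals $$ \begin{cases} (p-1)(d+1)-2nL(T_1)-2mL(T_2)+1, & \text{if } |W(T_1)|=|W(T_2)|=1,\\ (p-1)d-2nL(T_1)-2mL(T_2), & \text{if } |W(T_1)|\cdot|W(T_2)|=2,\\ (p-1)(d-1)-2nL(T_1)-2mL(T_2)+1, & \text{if } |W(T_1)|=|W(T_2)|=2, \end{cases} $$ if and only if there exists a feasible ordering $(z_0,\ldots,z_{p-1})$ of $V(G)$ such that all of the following hold: (a) $L(z_0)+L(z_{p-1})=1$ when $|W(G)|=1$, and $L(z_0)+L(z_{p-1})=0$ when $|W(G)|\ge 2$; (b) $L(z_s)\le \frac{d+1-2\xi}{2}$ for all $0\le s\le p-1$, except when $|W(G)|=4$ and $s\in\{p/2-1,p/2\}$, in which case $L(z_s)\le\frac{d+3-2\xi}{2}$; (c) any two non-feasible vertices $z_a,z_b$ with $0\le a<b\le p-1$ satisfy $$\phi(z_a,z_b)\le (b-a-1)\Big(\frac{d+1-\xi}{2}\Big)-\sum_{t=a+1}^{b-1}L(z_t)-\frac{\xi-\delta(z_a,z_b)-1}{2}$$ if $|W(G)|=4$ and $\{p/2-1,p/2\}\subseteq\{a,a+1,\ldots,b\}$, and $$\phi(z_a,z_b)\le (b-a-1)\Big(\frac{d+1-\xi}{2}\Big)-\sum_{t=a+1}^{b-1}L(z_t)-\frac{\xi-\delta(z_a,z_b)}{2}$$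 otherwise. Moreover, if such an ordering satisfies (a), (b), (c), then the mapping $f$ defined by $f(z_0)=0$ and $f(z_{i+1})=f(z_i)+d+1-L(z_i)-L(z_{i+1})-\delta(z_i,z_{i+1})$ for $0\le i\le p-2$ is an optimal radio labeling of $G$ (i.e. a radio labeling of span ${\rm rn}(G)$).
   Context: All graphs are finite, simple and connected; $d(u,v)$ is the distance and ${\rm diam}(G)$ the diameter. A radio labeling of $G$ is a map $f:V(G)\to\mathbb{Z}_{\ge 0}$ with $|f(u)-f(v)|\geq {\rm diam}(G)+1-d(u,v)$ for all distinct $u,v$; its span is $\max f-\min f$, and ${\rm rn}(G)$ is the minimum span. For a graph $H$ and $v\in V(H)$, $w_H(v)=\sum_{u\in V(H)}d(u,v)$; weight centers minimize $w_H$, and $W(H)$ is their set. A tree $T$ has one or two weight centers, adjacent if two. The level is $L_T(u)=\min_{w\in W(T)}d(u,w)$ and $L(T)=\sum_u L_T(u)$. Root $T$ at its weight center(s): $u$ is an ancestor of $v$ if the unique path from $v$ to its nearest weight center passes through $u$ (every vertex is its own ancestor). $\phi_T(u,v)=\max\{L_T(z): z$ a common ancestor of $u,v\}$ (0 if none). $\delta_T(u,v)=1$ if $W(T)=\{w,w'\}$ and $u,v$ lie in different components of $T-ww'$, else $0$. For $G=T_1\Box T_2$ and $z=(x,y)$: $L(z)=L_{T_1}(x)+L_{T_2}(y)$, $\phi(z_a,z_b)=\phi_{T_1}(x_a,x_b)+\phi_{T_2}(y_a,y_b)$, $\delta(z_a,z_b)=\delta_{T_1}(x_a,x_b)+\delta_{T_2}(y_a,y_b)$.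 $W(G)=W(T_1)\times W(T_2)$. Vertices $z_a,z_b$ are feasible if $\phi(z_a,z_b)=0$ and $\delta(z_a,z_b)=\xi$ (different/opposite/separate sectors when $|W(G)|=1/2/4$), non-feasible otherwise. An ordering $(z_0,\ldots,z_{p-1})$ of $V(G)$ is feasible if $z_t,z_{t+1}$ are feasible for all $0\le t\le p-2$, except that when $|W(G)|=4$ and $t=p/2-1$ one instead requires $\phi(z_{p/2-1},z_{p/2})=0$ and $\delta(z_{p/2-1},z_{p/2})=1$. *)

theory Defs
  imports Complex_Main "Graph_Theory.Graph_Theory"
begin

text \<open>
  A finite simple undirected graph is a \<^locale>\<open>pair_graph\<close>: finite, loopfree and symmetric, an
  undirected edge \<open>uv\<close> being the two arcs \<open>(u,v)\<close> and \<open>(v,u)\<close>.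
\<close>

section \<open>Distance, diameter and trees\<close>

definition gdist :: "'a pair_pre_digraph \<Rightarrow> 'a \<Rightarrow> 'a \<Rightarrow> nat" where
  "gdist G u v = (LEAST k. \<exists>q. pre_digraph.awalk G u q v \<and> length q = k)"

definition gdiam :: "'a pair_pre_digraph \<Rightarrow> nat" where
  "gdiam G = Max {gdist G u v | u v. u \<in> pverts G \<and> v \<in> pverts G}"

text \<open>
  The library's \<^const>\<open>forest\<close>, hence \<^const>\<open>tree\<close>, counts the closed walk \<open>u, v, u\<close> as a cycle, so
  that no symmetric digraph with an arc is a tree in that sense. Cycles of an undirected graph are
  the library's cycles of length at least 3.
\<close>

definition undirected_tree :: "'a pair_pre_digraph \<Rightarrow> bool" where
  "undirected_tree T \<longleftrightarrow> pair_graph T \<and> Digraph_Component.connected T \<and>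
     \<not> (\<exists>q. pre_digraph.cycle T q \<and> 3 \<le> length q)"

section \<open>Radio labelings\<close>

text \<open>
  Labels are non-negative integers; type \<^typ>\<open>int\<close> is used so that subtraction is not truncated.
\<close>

definition radio_labeling :: "'a pair_pre_digraph \<Rightarrow> ('a \<Rightarrow> int) \<Rightarrow> bool" where
  "radio_labeling G f \<longleftrightarrow> (\<forall>v \<in> pverts G. 0 \<le> f v) \<and>
     (\<forall>u \<in> pverts G. \<forall>v \<in> pverts G. u \<noteq> v \<longrightarrow>
        \<bar>f u - f v\<bar> \<ge> int (gdiam G) + 1 - int (gdist G u v))"

definition label_span :: "'a pair_pre_digraph \<Rightarrow> ('a \<Rightarrow> int) \<Rightarrow> int" where
  "label_span G f = Max (f ` pverts G) - Min (f ` pverts G)"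

definition radio_number :: "'a pair_pre_digraph \<Rightarrow> nat" where
  "radio_number G = (LEAST k. \<exists>f. radio_labeling G f \<and> label_span G f = int k)"

definition optimal_radio_labeling :: "'a pair_pre_digraph \<Rightarrow> ('a \<Rightarrow> int) \<Rightarrow> bool" where
  "optimal_radio_labeling G f \<longleftrightarrow>
     radio_labeling G f \<and> label_span G f = int (radio_number G)"

section \<open>Weight centers, levels, ancestors\<close>

definition weight :: "'a pair_pre_digraph \<Rightarrow> 'a \<Rightarrow> nat" where
  "weight H v = (\<Sum>u \<in> pverts H. gdist H u v)"

definition weight_centers :: "'a pair_pre_digraph \<Rightarrow> 'a set" where
  "weight_centers H = {v \<in> pverts H. \<forall>u \<in> pverts H. weight H v \<le> weight H u}"

definition level :: "'a pair_pre_digraph \<Rightarrow> 'a \<Rightarrow> nat" where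
  "level T u = Min (gdist T u ` weight_centers T)"

definition total_level :: "'a pair_pre_digraph \<Rightarrow> nat" where
  "total_level T = (\<Sum>u \<in> pverts T. level T u)"

text \<open>The nearest weight center of \<open>v\<close> is the \<open>w\<close> at distance \<open>level T v\<close> from \<open>v\<close>.\<close>

definition ancestor :: "'a pair_pre_digraph \<Rightarrow> 'a \<Rightarrow> 'a \<Rightarrow> bool" where
  "ancestor T u v \<longleftrightarrow> (\<exists>w \<in> weight_centers T. gdist T v w = level T v \<and>
     (\<exists>q. pre_digraph.apath T v q w \<and> u \<in> set (pre_digraph.awalk_verts T v q)))"

definition phi :: "'a pair_pre_digraph \<Rightarrow> 'a \<Rightarrow> 'a \<Rightarrow> nat" where
  "phi T u v = (let A = {z \<in> pverts T. ancestor T z u \<and> ancestor T z v}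
                in if A = {} then 0 else Max (level T ` A))"

definition remove_edge :: "'a pair_pre_digraph \<Rightarrow> 'a \<Rightarrow> 'a \<Rightarrow> 'a pair_pre_digraph" where
  "remove_edge T w w' = T\<lparr>parcs := parcs T - {(w, w'), (w', w)}\<rparr>"

definition delta :: "'a pair_pre_digraph \<Rightarrow> 'a \<Rightarrow> 'a \<Rightarrow> nat" where
  "delta T u v =
     (if \<exists>w w'. w \<noteq> w' \<and> weight_centers T = {w, w'} \<and>
           \<not> u \<rightarrow>\<^sup>*\<^bsub>with_proj (remove_edge T w w')\<^esub> v
      then 1 else 0)"

section \<open>Cartesian product of two trees\<close>

definition cart_prod ::
    "'a pair_pre_digraph \<Rightarrow> 'b pair_pre_digraph \<Rightarrow> ('a \<times> 'b) pair_pre_digraph" where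
  "cart_prod G H = \<lparr> pverts = pverts G \<times> pverts H,
     parcs = {((x, y), (x', y')).
        (x = x' \<and> x \<in> pverts G \<and> (y, y') \<in> parcs H) \<or>
        (y = y' \<and> y \<in> pverts H \<and> (x, x') \<in> parcs G)} \<rparr>"

definition prod_level :: "'a pair_pre_digraph \<Rightarrow> 'b pair_pre_digraph \<Rightarrow> 'a \<times> 'b \<Rightarrow> nat" where
  "prod_level T1 T2 z = level T1 (fst z) + level T2 (snd z)"

definition prod_phi ::
    "'a pair_pre_digraph \<Rightarrow> 'b pair_pre_digraph \<Rightarrow> 'a \<times> 'b \<Rightarrow> 'a \<times> 'b \<Rightarrow> nat" where
  "prod_phi T1 T2 z z' = phi T1 (fst z) (fst z') + phi T2 (snd z) (snd z')"

definition prod_delta ::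
    "'a pair_pre_digraph \<Rightarrow> 'b pair_pre_digraph \<Rightarrow> 'a \<times> 'b \<Rightarrow> 'a \<times> 'b \<Rightarrow> nat" where
  "prod_delta T1 T2 z z' = delta T1 (fst z) (fst z') + delta T2 (snd z) (snd z')"

definition prod_weight_centers ::
    "'a pair_pre_digraph \<Rightarrow> 'b pair_pre_digraph \<Rightarrow> ('a \<times> 'b) set" where
  "prod_weight_centers T1 T2 = weight_centers T1 \<times> weight_centers T2"

text \<open>No truncation occurs here: a tree has at least one weight center.\<close>

definition xi :: "'a pair_pre_digraph \<Rightarrow> 'b pair_pre_digraph \<Rightarrow> nat" where
  "xi T1 T2 = card (weight_centers T1) + card (weight_centers T2) - 2"

definition feasible ::
    "'a pair_pre_digraph \<Rightarrow> 'b pair_pre_digraph \<Rightarrow> 'a \<times> 'b \<Rightarrow> 'a \<times> 'b \<Rightarrow> bool" where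
  "feasible T1 T2 z z' \<longleftrightarrow> prod_phi T1 T2 z z' = 0 \<and> prod_delta T1 T2 z z' = xi T1 T2"

section \<open>Orderings of the vertices\<close>

text \<open>
  An ordering is given by its values \<open>z 0, \<dots>, z (p - 1)\<close>; other values of \<open>z\<close> are irrelevant. The
  index \<open>p div 2\<close> is used only when \<open>|W(G)| = 4\<close>. Then \<open>T1\<close> and \<open>T2\<close> have two weight centers each,
  hence even orders, so that \<open>p div 2 = p/2\<close>.
\<close>

definition feasible_ordering ::
    "'a pair_pre_digraph \<Rightarrow> 'b pair_pre_digraph \<Rightarrow> (nat \<Rightarrow> 'a \<times> 'b) \<Rightarrow> bool" where
  "feasible_ordering T1 T2 z \<longleftrightarrow>
     (let p = card (pverts (cart_prod T1 T2)) in
        bij_betw z {0..<p} (pverts (cart_prod T1 T2)) \<and>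
        (\<forall>t. t + 1 < p \<longrightarrow>
           (if card (prod_weight_centers T1 T2) = 4 \<and> t = p div 2 - 1
            then prod_phi T1 T2 (z t) (z (t + 1)) = 0 \<and> prod_delta T1 T2 (z t) (z (t + 1)) = 1
            else feasible T1 T2 (z t) (z (t + 1)))))"

definition end_level_condition ::
    "'a pair_pre_digraph \<Rightarrow> 'b pair_pre_digraph \<Rightarrow> (nat \<Rightarrow> 'a \<times> 'b) \<Rightarrow> bool" where
  "end_level_condition T1 T2 z \<longleftrightarrow>
     (let p = card (pverts (cart_prod T1 T2)); L = prod_level T1 T2 in
        (card (prod_weight_centers T1 T2) = 1 \<longrightarrow> L (z 0) + L (z (p - 1)) = 1) \<and>
        (card (prod_weight_centers T1 T2) \<ge> 2 \<longrightarrow> L (z 0) + L (z (p - 1)) = 0))"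

definition level_bound_condition ::
    "'a pair_pre_digraph \<Rightarrow> 'b pair_pre_digraph \<Rightarrow> (nat \<Rightarrow> 'a \<times> 'b) \<Rightarrow> bool" where
  "level_bound_condition T1 T2 z \<longleftrightarrow>
     (let p = card (pverts (cart_prod T1 T2));
          d = real (gdiam T1 + gdiam T2);
          \<xi> = real (xi T1 T2)
      in \<forall>s < p. real (prod_level T1 T2 (z s)) \<le>
           (if card (prod_weight_centers T1 T2) = 4 \<and> s \<in> {p div 2 - 1, p div 2}
            then (d + 3 - 2 * \<xi>) / 2
            else (d + 1 - 2 * \<xi>) / 2))"

definition phi_bound_condition ::
    "'a pair_pre_digraph \<Rightarrow> 'b pair_pre_digraph \<Rightarrow> (nat \<Rightarrow> 'a \<times> 'b) \<Rightarrow> bool" where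
  "phi_bound_condition T1 T2 z \<longleftrightarrow>
     (let p = card (pverts (cart_prod T1 T2));
          d = real (gdiam T1 + gdiam T2);
          \<xi> = real (xi T1 T2)
      in \<forall>a b. a < b \<and> b < p \<and> \<not> feasible T1 T2 (z a) (z b) \<longrightarrow>
           real (prod_phi T1 T2 (z a) (z b)) \<le>
             (real b - real a - 1) * ((d + 1 - \<xi>) / 2)
             - (\<Sum>t \<in> {a<..<b}. real (prod_level T1 T2 (z t)))
             - (if card (prod_weight_centers T1 T2) = 4 \<and> {p div 2 - 1, p div 2} \<subseteq> {a..b}
                then (\<xi> - real (prod_delta T1 T2 (z a) (z b)) - 1) / 2
                else (\<xi> - real (prod_delta T1 T2 (z a) (z b))) / 2))"

end

theory Submission
  imports Defs
begin

text \<open>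
  In a tree, two vertices \<open>u\<close>, \<open>v\<close> with a common nearest weight center have a median with it, whose
  level is \<open>\<phi>(u, v)\<close>; this yields \<open>d(u, v) = L(u) + L(v) - 2\<phi>(u, v) + \<delta>(u, v)\<close>, also in the product.
  Listing the vertices by increasing label and adding up the constraints for consecutive vertices
  bounds the span from below by \<open>(p - 1)(d + 1 - \<xi>) - 2\<Sum>L\<close> plus the cost
  \<open>L(z\<^sub>0) + L(z\<^bsub>p-1\<^esub>) + \<Sum>(2\<phi> + \<xi> - \<delta>)\<close>, where the last sum is over consecutive vertices.
  The cost is at least 1, 0, 1 for \<open>\<xi> = 0, 1, 2\<close>. For \<open>\<xi> = 0\<close> this is because there is only one
  vertex of level 0. For \<open>\<xi> = 2\<close> it is because steps with \<open>\<delta> = 2\<close> never leave a pair of opposite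
  quarters of the vertex set; by counting, a single exceptional step must be the middle one. Orderings of
  minimal cost are the feasible ones with condition (a), and for the labeling with all consecutive
  constraints tight the remaining constraints amount to (b) and (c).
\<close>

section \<open>Distances in graphs and trees\<close>

text \<open>Both directions meet in \<open>pair_bound\<close>, the radio constraint for the vertices
  at positions a < b when all consecutive constraints are tight. The label difference telescopes and
  the distance formula cancels the levels of the two end vertices, so that only \<phi>, \<delta>,
  the levels strictly between and the exceptional middle step remain. For non-feasible pairs this is
  (c). For feasible pairs \<phi> = 0 and \<delta> = \<xi>, and it suffices that every level in
  between is at most (d + 1 - \<xi>)/2, which (b) implies. Conversely, (b) comes from positions s -
  1 and s + 1: two steps with \<delta> = \<xi> bring each coordinate whose tree has two weight
  centers back to its half, so \<delta> = 0 between these vertices, while each of the two steps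
  loses \<xi>. If one of the steps is the exceptional one, it lengthens the label difference by 1
  and \<delta> may be 1, whence the constant 3 in place of 1. The end positions have no such pair;
  there (a) and d \<ge> 4 suffice.\<close>

lemma (in pair_wf_digraph) awalk_length_iff_relpow:
  assumes "u \<in> pverts G"
  shows "(\<exists>q. awalk u q v \<and> length q = k) \<longleftrightarrow> (u, v) \<in> parcs G ^^ k"
  using assms
proof (induction k arbitrary: u)
  case 0
  then show ?case by (auto simp: awalk_Nil_iff)
next
  case (Suc k)
  have "(\<exists>q. awalk u q v \<and> length q = Suc k) \<longleftrightarrow>
      (\<exists>s q. (u, s) \<in> parcs G \<and> awalk s q v \<and> length q = k)"
  proof (intro iffI; elim exE conjE)
    fix q assume "awalk u q v" "length q = Suc k"
    then show "\<exists>s q. (u, s) \<in> parcs G \<and> awalk s q v \<and> length q = k"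
      by (cases q) (auto simp: awalk_Cons_iff intro!: exI)
  next
    fix s q assume "(u, s) \<in> parcs G" "awalk s q v" "length q = k"
    then show "\<exists>q. awalk u q v \<and> length q = Suc k"
      by (intro exI[of _ "(u, s) # q"]) (simp add: awalk_Cons_iff)
  qed
  also have "\<dots> \<longleftrightarrow> (\<exists>s. (u, s) \<in> parcs G \<and> (s, v) \<in> parcs G ^^ k)"
    using Suc.IH in_arcsD2 by blast
  also have "\<dots> \<longleftrightarrow> (u, v) \<in> parcs G ^^ Suc k"
    by (metis relpow_Suc_I2 relpow_Suc_D2)
  finally show ?case .
qed

lemma (in pair_wf_digraph) gdist_eq_Least_relpow:
  assumes "u \<in> pverts G"
  shows "gdist G u v = (LEAST k. (u, v) \<in> parcs G ^^ k)"
  unfolding gdist_def by (rule arg_cong[where f = Least], rule ext)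
    (rule awalk_length_iff_relpow[OF assms])

text \<open>Connectedness is stated with relation powers because distances are computed as least
  exponents, and both pass to the product coordinatewise.\<close>

locale connected_pair_graph = pair_graph +
  assumes relpow_connected: "u \<in> pverts G \<Longrightarrow> v \<in> pverts G \<Longrightarrow> \<exists>k. (u, v) \<in> parcs G ^^ k"
    and verts_nonempty: "pverts G \<noteq> {}"
begin

abbreviation d :: "'a \<Rightarrow> 'a \<Rightarrow> nat" where "d \<equiv> gdist G"
abbreviation V :: "'a set" where "V \<equiv> pverts G"
abbreviation E :: "'a \<Rightarrow> 'a \<Rightarrow> bool" where "E u v \<equiv> (u, v) \<in> parcs G"

lemma E_sym: "E u v \<Longrightarrow> E v u"
  by (rule arcs_symmetric)

lemma E_neq: "E u v \<Longrightarrow> u \<noteq> v"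
  by (rule no_loops')

lemma relpow_sym: "(u, v) \<in> parcs G ^^ k \<Longrightarrow> (v, u) \<in> parcs G ^^ k"
proof (induction k arbitrary: v)
  case (Suc k)
  then show ?case by (metis E_sym relpow_Suc_E relpow_Suc_I2)
qed simp

lemma gdist_relpow:
  assumes "u \<in> V" "v \<in> V"
  shows "(u, v) \<in> parcs G ^^ d u v"
  unfolding gdist_eq_Least_relpow[OF assms(1)]
  using relpow_connected[OF assms] by (rule LeastI_ex)

lemma gdist_le:
  assumes "u \<in> V" "(u, v) \<in> parcs G ^^ k"
  shows "d u v \<le> k"
  unfolding gdist_eq_Least_relpow[OF assms(1)] using assms(2) by (rule Least_le)

lemma gdist_sym:
  assumes "u \<in> V" "v \<in> V"
  shows "d u v = d v u"
proof (rule antisym)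
  show "d u v \<le> d v u"
    using assms by (intro gdist_le relpow_sym[OF gdist_relpow])
  show "d v u \<le> d u v"
    using assms by (intro gdist_le relpow_sym[OF gdist_relpow])
qed

lemma gdist_triangle:
  assumes "u \<in> V" "v \<in> V" "w \<in> V"
  shows "d u w \<le> d u v + d v w"
proof (rule gdist_le[OF assms(1)])
  show "(u, w) \<in> parcs G ^^ (d u v + d v w)"
    unfolding relpow_add using gdist_relpow assms by blast
qed

lemma gdist_eq_0_iff:
  assumes "u \<in> V" "v \<in> V"
  shows "d u v = 0 \<longleftrightarrow> u = v"
proof
  assume "d u v = 0"
  then show "u = v" using gdist_relpow[OF assms] by simp
next
  assume "u = v"
  then have "d u v \<le> 0" by (intro gdist_le assms) simp
  then show "d u v = 0" by simp
qed

lemma gdist_self [simp]: "u \<in> V \<Longrightarrow> d u u = 0"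
  by (simp add: gdist_eq_0_iff)

lemma E_in_V: "E u v \<Longrightarrow> u \<in> V \<and> v \<in> V"
  using wellformed' by blast

lemma gdist_E:
  assumes "E u v"
  shows "d u v = 1"
proof -
  have "d u v \<le> 1" using assms E_in_V by (intro gdist_le) auto
  moreover have "d u v \<noteq> 0" using assms E_in_V E_neq gdist_eq_0_iff by auto
  ultimately show ?thesis by simp
qed

lemma gdist_1_E:
  assumes "u \<in> V" "v \<in> V" "d u v = 1"
  shows "E u v"
  using gdist_relpow[OF assms(1,2)] assms(3) by simp

lemma gdist_step_le:
  assumes "E s t" "u \<in> V"
  shows "d s u \<le> Suc (d t u)" "d u s \<le> Suc (d u t)"
  using gdist_triangle[of s t u] gdist_triangle[of u t s] gdist_E[OF assms(1)]
    gdist_E[OF E_sym[OF assms(1)]] E_in_V[OF assms(1)] assms(2) by auto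

lemma gdist_first_step:
  assumes "u \<in> V" "v \<in> V" "u \<noteq> v"
  obtains s where "E u s" "d u v = Suc (d s v)"
proof -
  obtain k where k: "d u v = Suc k"
    using assms gdist_eq_0_iff not0_implies_Suc by metis
  then obtain s where s: "E u s" "(s, v) \<in> parcs G ^^ k"
    using gdist_relpow[OF assms(1,2)] by (metis relpow_Suc_E2)
  have "d s v \<le> k" using s E_in_V by (intro gdist_le) auto
  with gdist_step_le(1)[OF s(1) assms(2)] k s(1) that show ?thesis by auto
qed

text \<open>If the first vertex recurred, the part of the walk from its recurrence on would be a
  shorter walk to \<open>v\<close>.\<close>

lemma shortest_awalk_apath:
  assumes "awalk u q v" "length q = d u v"
  shows "apath u q v"
  using assms
proof (induction q arbitrary: u)
  case Nil
  then show ?case by (auto simp: awalk_Nil_iff apath_Nil_iff)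
next
  case (Cons e q)
  then obtain s where e: "e = (u, s)" "E u s" and q: "awalk s q v"
    by (cases e) (auto simp: awalk_Cons_iff)
  have sV: "s \<in> V" "v \<in> V" "u \<in> V" using e E_in_V q by auto
  have "d s v \<le> length q"
    using awalk_length_iff_relpow[OF sV(1)] gdist_le[OF sV(1)] q by blast
  with gdist_step_le(1)[OF e(2) sV(2)] Cons.prems have len: "length q = d s v" by simp
  have "u \<notin> set (awalk_verts s q)"
  proof
    assume "u \<in> set (awalk_verts s q)"
    then obtain q1 q2 where "q = q1 @ q2" "awalk u q2 v"
      using awalk_decomp[OF q] by blast
    then have "d u v \<le> length q"
      using awalk_length_iff_relpow[OF sV(3)] gdist_le[OF sV(3)]
      by (metis length_append trans_le_add2)
    with Cons.prems show False by simp
  qed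
  with Cons.IH[OF q len] e show ?case by (simp add: apath_Cons_iff)
qed

lemma gdist_le_gdiam:
  assumes "u \<in> V" "v \<in> V"
  shows "d u v \<le> gdiam G"
  unfolding gdiam_def
proof (rule Max_ge)
  have "{d u v | u v. u \<in> V \<and> v \<in> V} = (\<lambda>(u, v). d u v) ` (V \<times> V)" by auto
  then show "finite {d u v | u v. u \<in> V \<and> v \<in> V}" by simp
qed (use assms in auto)

lemma gdiam_attained:
  obtains u v where "u \<in> V" "v \<in> V" "d u v = gdiam G"
proof -
  have eq: "{d u v | u v. u \<in> V \<and> v \<in> V} = (\<lambda>(u, v). d u v) ` (V \<times> V)" by auto
  have "gdiam G \<in> {d u v | u v. u \<in> V \<and> v \<in> V}"
    unfolding gdiam_def by (rule Max_in) (use verts_nonempty eq in auto)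
  then show ?thesis using that by auto
qed

end

section \<open>Trees: uniqueness of paths, first steps and medians\<close>

locale utree = connected_pair_graph +
  assumes no_long_cycle: "cycle q \<Longrightarrow> length q < 3"
begin

text \<open>Paths are treated as lists of vertices, which are easily reversed and spliced. This
  lemma leads back to lists of arcs, in which cycles are defined.\<close>

lemma successively_awalk:
  assumes "successively E xs" "xs \<noteq> []" "set xs \<subseteq> V"
  shows "\<exists>q. awalk (hd xs) q (last xs) \<and> awalk_verts (hd xs) q = xs"
  using assms
proof (induction xs rule: induct_list012)
  case (2 x)
  then show ?case by (auto intro!: exI[of _ "[]"] simp: awalk_Nil_iff)
next
  case (3 x y zs)
  then obtain q where "awalk y q (last (y # zs))" "awalk_verts y q = y # zs" by auto
  with 3 show ?case
    by (intro exI[of _ "(x, y) # q"]) (auto simp: awalk_Cons_iff)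
qed simp

lemma no_closed_list:
  assumes "successively E xs" "set xs \<subseteq> V" "distinct xs" "3 \<le> length xs" "E (last xs) (hd xs)"
  shows False
proof -
  have ne: "xs \<noteq> []" using assms(4) by auto
  obtain q where q: "awalk (hd xs) q (last xs)" "awalk_verts (hd xs) q = xs"
    using successively_awalk[OF assms(1) ne assms(2)] by blast
  \<comment> \<open>With the closing arc in front, the vertex sequence of \<open>?c\<close> without
    its head is exactly \<open>xs\<close>, hence distinct.\<close>
  let ?c = "(last xs, hd xs) # q"
  have "cycle ?c"
    unfolding cycle_def
  proof (intro exI[of _ "last xs"] conjI)
    show "awalk (last xs) ?c (last xs)" using q assms(5) E_in_V by (simp add: awalk_Cons_iff)
    show "distinct (tl (awalk_verts (last xs) ?c))" using q assms(3) by simp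
  qed simp
  moreover have "length q = length xs - 1" using q(2) length_awalk_verts[of "hd xs" q] by simp
  ultimately show False using no_long_cycle[of ?c] assms(4) by simp
qed

text \<open>Where the paths part, follow \<open>xs\<close> up to its first vertex \<open>x\<close>
  on the other path and return along that path. This closes a cycle through \<open>a\<close>; its
  length is at least 3 because the next vertices differ, so that \<open>xs1\<close> and
  \<open>ys1\<close> are not both empty.\<close>

lemma unique_vertex_path:
  assumes "successively E xs" "successively E ys" "set xs \<subseteq> V" "set ys \<subseteq> V"
    "distinct xs" "distinct ys" "xs \<noteq> []" "ys \<noteq> []" "hd xs = hd ys" "last xs = last ys"
  shows "xs = ys"
  using assms
proof (induction xs arbitrary: ys)
  case (Cons a xs)
  obtain ys' where ys: "ys = a # ys'" using Cons.prems by (cases ys) auto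
  show ?case
  proof (cases "xs = [] \<or> ys' = []")
    case True
    then show ?thesis using Cons.prems ys
      by (metis distinct.simps(2) last.simps last_in_set)
  next
    case False
    then have ne: "xs \<noteq> []" "ys' \<noteq> []" by auto
    show ?thesis
    proof (cases "hd xs = hd ys'")
      case True
      have "xs = ys'"
        by (rule Cons.IH) (use Cons.prems ys ne True in \<open>auto simp: successively_Cons\<close>)
      then show ?thesis using ys by simp
    next
      case heads: False
      have "last xs = last ys'" using Cons.prems ys ne by simp
      then have "last xs \<in> set xs" "last xs \<in> set ys'" using ne last_in_set by metis+
      then obtain xs1 x xs2 where xs: "xs = xs1 @ x # xs2" "x \<in> set ys'" "\<forall>z \<in> set xs1. z \<notin> set ys'"
        using split_list_first_prop[of xs "\<lambda>z. z \<in> set ys'"] by blast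
      then obtain ys1 ys2 where ys': "ys' = ys1 @ x # ys2" by (meson split_list)
      let ?c = "a # xs1 @ x # rev ys1"
      have sx: "successively E ((a # xs1 @ [x]) @ xs2)" and sy: "successively E ((a # ys1 @ [x]) @ ys2)"
        using Cons.prems(1,2) ys xs ys' by auto
      have s1: "successively E (a # xs1 @ [x])" "successively E (a # ys1 @ [x])"
        using sx sy unfolding successively_append_iff by blast+
      have "successively E (rev (a # ys1 @ [x]))"
        using s1(2) unfolding successively_rev by (rule successively_mono) (rule E_sym)
      then have r: "successively E (x # rev ys1 @ [a])" by simp
      then have "successively E ((x # rev ys1) @ [a])" by simp
      then have r1: "successively E (x # rev ys1)" "E (last (x # rev ys1)) a"
        unfolding successively_append_iff by auto
      have c: "successively E ?c"
        using s1(1) r1(1) successively_append_iff[of E "a # xs1" "[x]"]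
          successively_append_iff[of E "a # xs1" "x # rev ys1"] by simp
      have "set ?c \<subseteq> V" "distinct ?c"
        using Cons.prems ys xs ys' by auto
      moreover have "3 \<le> length ?c"
        using heads xs(1) ys' by (cases xs1; cases ys1) auto
      moreover have "E (last ?c) (hd ?c)" using r1(2) by (simp add: last_append)
      ultimately show ?thesis using no_closed_list[OF c] by blast
    qed
  qed
qed simp

text \<open>The last clause serves to put a further vertex in front: one that is no closer to
  \<open>v\<close> than \<open>u\<close>, and not \<open>u\<close> itself, cannot occur in the
  list.\<close>

lemma geodesic_vertex_path:
  assumes "u \<in> V" "v \<in> V"
  obtains xs where "xs \<noteq> []" "hd xs = u" "last xs = v" "successively E xs" "distinct xs"
    "length xs = Suc (d u v)" "\<And>x. x \<in> set xs \<Longrightarrow> x \<in> V \<and> (x = u \<or> d x v < d u v)"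
  using assms
proof (induction "d u v" arbitrary: u thesis)
  case 0
  then have "u = v" using gdist_eq_0_iff by auto
  with 0 show ?case by (intro "0.prems"(1)[of "[u]"]) auto
next
  case (Suc k)
  then have "u \<noteq> v" using gdist_eq_0_iff by auto
  then obtain s where s: "E u s" "d u v = Suc (d s v)"
    using gdist_first_step Suc.prems by blast
  obtain xs where xs: "xs \<noteq> []" "hd xs = s" "last xs = v" "successively E xs" "distinct xs"
    "length xs = Suc (d s v)" "\<And>x. x \<in> set xs \<Longrightarrow> x \<in> V \<and> (x = s \<or> d x v < d s v)"
    using Suc.hyps(1)[of s] Suc.hyps(2) s E_in_V Suc.prems by auto
  have "u \<notin> set xs" using xs(7)[of u] s by auto
  with xs s Suc.prems(2) show ?case
    by (intro Suc.prems(1)[of "u # xs"]) (auto simp: successively_Cons dest: xs(7))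
qed

text \<open>Geodesics from \<open>b\<close> and from \<open>b'\<close>, each prefixed by
  \<open>a\<close>, are two paths from \<open>a\<close> to \<open>v\<close> and therefore
  equal.\<close>

lemma first_step_unique:
  assumes "E a b" "E a b'" "v \<in> V" "d a v = Suc (d b v)" "d a v = Suc (d b' v)"
  shows "b = b'"
proof -
  have bV: "a \<in> V" "b \<in> V" "b' \<in> V" using assms E_in_V by auto
  obtain xs where xs: "xs \<noteq> []" "hd xs = b" "last xs = v" "successively E xs" "distinct xs"
    "\<And>x. x \<in> set xs \<Longrightarrow> x \<in> V \<and> (x = b \<or> d x v < d b v)"
    by (rule geodesic_vertex_path[OF bV(2) assms(3)]) blast
  obtain ys where ys: "ys \<noteq> []" "hd ys = b'" "last ys = v" "successively E ys" "distinct ys"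
    "\<And>x. x \<in> set ys \<Longrightarrow> x \<in> V \<and> (x = b' \<or> d x v < d b' v)"
    by (rule geodesic_vertex_path[OF bV(3) assms(3)]) blast
  have "a \<notin> set xs" "a \<notin> set ys" using xs(6)[of a] ys(6)[of a] assms by auto
  then have "a # xs = a # ys"
    using xs ys assms bV by (intro unique_vertex_path) (auto simp: successively_Cons)
  with xs ys show ?thesis by simp
qed

text \<open>Trees are bipartite. Here: a geodesic from \<open>a\<close>, and a geodesic from
  \<open>b\<close> prefixed by \<open>a\<close>, would be two paths to \<open>u\<close> of different
  lengths.\<close>

lemma gdist_adjacent_neq:
  assumes "E a b" "u \<in> V"
  shows "d u a \<noteq> d u b"
proof
  assume eq: "d u a = d u b"
  have bV: "a \<in> V" "b \<in> V" using assms E_in_V by auto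
  obtain xs where xs: "xs \<noteq> []" "hd xs = a" "last xs = u" "successively E xs" "distinct xs"
    "length xs = Suc (d a u)" "\<And>x. x \<in> set xs \<Longrightarrow> x \<in> V \<and> (x = a \<or> d x u < d a u)"
    by (rule geodesic_vertex_path[OF bV(1) assms(2)]) blast
  obtain ys where ys: "ys \<noteq> []" "hd ys = b" "last ys = u" "successively E ys" "distinct ys"
    "length ys = Suc (d b u)" "\<And>x. x \<in> set ys \<Longrightarrow> x \<in> V \<and> (x = b \<or> d x u < d b u)"
    by (rule geodesic_vertex_path[OF bV(2) assms(2)]) blast
  have eq': "d a u = d b u" using eq gdist_sym bV assms(2) by simp
  have "a \<notin> set ys" using ys(7)[of a] eq' E_neq[OF assms(1)] by auto
  then have "a # ys = xs"
    using xs ys assms bV by (intro unique_vertex_path) (auto simp: successively_Cons)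
  then have "length xs = Suc (length ys)" by auto
  with xs(6) ys(6) eq' show False by simp
qed

lemma gdist_adjacent_cases:
  assumes "E a b" "u \<in> V"
  shows "d u a = Suc (d u b) \<or> d u b = Suc (d u a)"
  using gdist_adjacent_neq[OF assms] gdist_step_le(2)[OF assms] gdist_step_le(2)[OF E_sym[OF assms(1)] assms(2)]
  by linarith

end

context utree
begin

text \<open>Move \<open>w\<close> one step to \<open>s\<close>, towards \<open>v\<close> and so away
  from \<open>u\<close>. The hypothesis persists: by uniqueness of first steps the only neighbour of
  \<open>s\<close> closer to \<open>u\<close> is \<open>w\<close>, which is farther from
  \<open>v\<close>.\<close>

lemma gdist_add_of_no_common_step:
  assumes "u \<in> V" "v \<in> V" "w \<in> V"
    and "\<And>s. E w s \<Longrightarrow> d w u = Suc (d s u) \<Longrightarrow> d w v = Suc (d s v) \<Longrightarrow> False"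
  shows "d u v = d u w + d w v"
  using assms(3,4)
proof (induction "d w v" arbitrary: w)
  case 0
  then have "w = v" using gdist_eq_0_iff assms(2) by auto
  then show ?case using assms(2) by simp
next
  case (Suc k)
  have "w \<noteq> v" using Suc.hyps(2) assms(2) by auto
  then obtain s where s: "E w s" "d w v = Suc (d s v)"
    using gdist_first_step Suc.prems(1) assms(2) by blast
  have sV: "s \<in> V" using s E_in_V by auto
  have sym: "d u w = d w u" "d u s = d s u" using gdist_sym assms(1) Suc.prems(1) sV by auto
  have us: "d u s = Suc (d u w)"
    using gdist_adjacent_cases[OF s(1) assms(1)] Suc.prems(2)[OF s(1) _ s(2)] sym by auto
  have "d u v = d u s + d s v"
  proof (rule Suc.hyps(1)[OF _ sV])
    show "k = d s v" using s Suc.hyps(2) by simp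
    fix t assume t: "E s t" "d s u = Suc (d t u)" "d s v = Suc (d t v)"
    have "t = w" using first_step_unique[OF t(1) E_sym[OF s(1)] assms(1) t(2)] us sym by simp
    then show False using t s by simp
  qed
  then show ?case using us s by simp
qed

text \<open>As long as the geodesics from \<open>w\<close> to \<open>u\<close> and to
  \<open>v\<close> share their first step, move \<open>w\<close> along it. Where they part,
  \<open>w\<close> itself lies between \<open>u\<close> and \<open>v\<close>.\<close>

lemma median_exists:
  assumes "u \<in> V" "v \<in> V" "w \<in> V"
  obtains z where "z \<in> V" "d u z + d z v = d u v" "d w z + d z u = d w u" "d w z + d z v = d w v"
  using assms(3)
proof (induction "d w u" arbitrary: w thesis)
  case 0
  then have "w = u" using gdist_eq_0_iff[of w u] assms(1) by metis
  with assms show ?case by (intro "0.prems"(1)[of u]) simp_all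
next
  case (Suc k)
  show ?case
  proof (cases "\<exists>s. E w s \<and> d w u = Suc (d s u) \<and> d w v = Suc (d s v)")
    case True
    then obtain s where s: "E w s" "d w u = Suc (d s u)" "d w v = Suc (d s v)" by blast
    have sV: "s \<in> V" using s E_in_V by auto
    obtain z where z: "z \<in> V" "d u z + d z v = d u v" "d s z + d z u = d s u" "d s z + d z v = d s v"
      using Suc.hyps(1)[of s] Suc.hyps(2) s sV by auto
    have "d w z \<le> Suc (d s z)" using gdist_step_le(1)[OF s(1) z(1)] .
    then show ?thesis
      using gdist_triangle[OF Suc.prems(2) z(1) assms(1)] gdist_triangle[OF Suc.prems(2) z(1) assms(2)]
        s z by (intro Suc.prems(1)[OF z(1)]) auto
  next
    case False
    then have "d u v = d u w + d w v"
      using gdist_add_of_no_common_step[OF assms(1,2) Suc.prems(2)] by blast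
    then show ?thesis using Suc.prems gdist_sym assms by auto
  qed
qed

text \<open>A first step towards \<open>z\<close> is also one towards \<open>w\<close>, as
  \<open>z\<close> lies between, and that one is unique.\<close>

lemma first_step_between:
  assumes "E a b" "w \<in> V" "d a w = Suc (d b w)"
    and z: "z \<in> V" "z \<noteq> a" "d a z + d z w = d a w"
  shows "d a z = Suc (d b z)"
proof -
  have aV: "a \<in> V" using assms(1) E_in_V by auto
  obtain s where s: "E a s" "d a z = Suc (d s z)" using gdist_first_step[OF aV z(1)] z(2) by metis
  have "s \<in> V" using s E_in_V by auto
  then have "d a w = Suc (d s w)"
    using gdist_triangle[of s z w] gdist_step_le(1)[OF s(1) assms(2)] z(1,3) assms(2) s(2) by simp
  then have "s = b" by (rule first_step_unique[OF s(1) assms(1,2) _ assms(3)])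
  with s show ?thesis by simp
qed

text \<open>By induction the rest of the path is a geodesic. If the first step led away from
  \<open>w\<close>, the rest would have to begin by stepping back to \<open>v\<close>, which a path
  does not revisit.\<close>

lemma apath_between:
  assumes "apath v q w"
  shows "length q = d v w \<and> (\<forall>x \<in> set (awalk_verts v q). d v x + d x w = d v w)"
  using assms
proof (induction q arbitrary: v)
  case Nil
  then show ?case by (auto simp: apath_Nil_iff)
next
  case (Cons e q)
  then obtain s where e: "e = (v, s)" "E v s" and q: "apath s q w" and v: "v \<notin> set (awalk_verts s q)"
    by (cases e) (auto simp: apath_Cons_iff)
  have IH: "length q = d s w" "\<And>x. x \<in> set (awalk_verts s q) \<Longrightarrow> d s x + d x w = d s w"
    using Cons.IH[OF q] by auto
  have wV: "w \<in> V" "v \<in> V" "s \<in> V" and aw: "awalk s q w"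
    using q E_in_V e by (auto simp: apath_def)
  have vw: "d v w = Suc (d s w)"
  proof (rule ccontr)
    assume "d v w \<noteq> Suc (d s w)"
    then have sv: "d s w = Suc (d v w)"
      using gdist_adjacent_cases[OF e(2) wV(1)] gdist_sym wV by metis
    then obtain r q' where q': "q = (s, r) # q'" "E s r" "apath r q' w"
      using q IH(1) by (cases q) (auto simp: apath_Cons_iff)
    have rV: "r \<in> V" using q' E_in_V by auto
    have "r \<in> set (awalk_verts s q)"
      using q' hd_in_awalk_verts(1)[of r q' w] by (auto simp: apath_def)
    then have "d s w = Suc (d r w)" using IH(2)[of r] gdist_E[OF q'(2)] by simp
    then have "r = v" using first_step_unique[OF q'(2) E_sym[OF e(2)] wV(1) _ sv] by blast
    with v \<open>r \<in> set (awalk_verts s q)\<close> show False by simp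
  qed
  have "d v x + d x w = d v w" if x: "x \<in> set (awalk_verts s q)" for x
  proof -
    have xV: "x \<in> V" using x aw by (auto dest: awalkE')
    show ?thesis
      using IH(2)[OF x] vw gdist_step_le(1)[OF e(2) xV] gdist_triangle[OF wV(2) xV wV(1)] by simp
  qed
  then show ?case using e vw IH(1) wV by auto
qed

text \<open>Turns the paths in the definition of ancestors into an equation between distances, the
  only form used later.\<close>

lemma apath_through_iff:
  assumes "v \<in> V" "w \<in> V"
  shows "(\<exists>q. apath v q w \<and> x \<in> set (awalk_verts v q)) \<longleftrightarrow> x \<in> V \<and> d v x + d x w = d v w"
proof
  assume "\<exists>q. apath v q w \<and> x \<in> set (awalk_verts v q)"
  then obtain q where q: "apath v q w" "x \<in> set (awalk_verts v q)" by blast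
  then have "x \<in> V" by (auto simp: apath_def dest: awalkE')
  then show "x \<in> V \<and> d v x + d x w = d v w" using apath_between q by blast
next
  assume x: "x \<in> V \<and> d v x + d x w = d v w"
  obtain p where p: "awalk v p x" "length p = d v x"
    using awalk_length_iff_relpow[of v x "d v x"] gdist_relpow[of v x] x assms by auto
  obtain r where r: "awalk x r w" "length r = d x w"
    using awalk_length_iff_relpow[of x w "d x w"] gdist_relpow[of x w] x assms by auto
  have "apath v (p @ r) w" using p r x by (intro shortest_awalk_apath) auto
  moreover have "x \<in> set (awalk_verts v (p @ r))"
    using p(1) r(1) by (metis UnI2 awalk_appendI hd_in_awalk_verts(1) set_awalk_verts_append)
  ultimately show "\<exists>q. apath v q w \<and> x \<in> set (awalk_verts v q)" by blast
qed

section \<open>Weight centers of a tree\<close>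

abbreviation W :: "'a set" where "W \<equiv> weight_centers G"

text \<open>For an edge \<open>ab\<close> this is the component of \<open>a\<close> after the edge
  is deleted, described by distances so that it can be counted and compared without walks.\<close>

definition side :: "'a \<Rightarrow> 'a \<Rightarrow> 'a set" where
  "side a b = {u \<in> V. d u a < d u b}"

lemma side_subset: "side a b \<subseteq> V"
  by (auto simp: side_def)

lemma finite_side [simp]: "finite (side a b)"
  using finite_subset[OF side_subset finite_verts] .

lemma side_cases:
  assumes "E a b" "u \<in> V"
  shows "u \<in> side a b \<and> u \<notin> side b a \<and> d u b = Suc (d u a) \<or>
    u \<in> side b a \<and> u \<notin> side a b \<and> d u a = Suc (d u b)"
  using gdist_adjacent_cases[OF assms] assms(2) by (auto simp: side_def)

lemma side_Un:
  assumes "E a b"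
  shows "side a b \<union> side b a = V" "side a b \<inter> side b a = {}"
  using side_cases[OF assms] side_subset by auto

lemma card_side:
  assumes "E a b"
  shows "card (side a b) + card (side b a) = card V"
  using card_Un_disjoint[of "side a b" "side b a"] side_Un[OF assms] by simp

text \<open>Passing from \<open>a\<close> to \<open>b\<close> raises the distance by 1 for each
  vertex on the side of \<open>a\<close> and lowers it by 1 for each vertex on the side of
  \<open>b\<close>.\<close>

lemma weight_adjacent:
  assumes "E a b"
  shows "weight G b + card (side b a) = weight G a + card (side a b)"
proof -
  have card: "card (side x y) = (\<Sum>u \<in> V. if u \<in> side x y then 1 else 0)" for x y
    using side_subset[of x y] by (simp add: sum.If_cases Int_absorb1)
  have "weight G b + card (side b a) = (\<Sum>u \<in> V. d u b + (if u \<in> side b a then 1 else 0))"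
    by (simp add: weight_def card sum.distrib)
  also have "\<dots> = (\<Sum>u \<in> V. d u a + (if u \<in> side a b then 1 else 0))"
  proof (intro sum.cong refl)
    fix u assume "u \<in> V"
    from side_cases[OF assms this]
    show "d u b + (if u \<in> side b a then 1 else 0) = d u a + (if u \<in> side a b then 1 else 0)" by auto
  qed
  also have "\<dots> = weight G a + card (side a b)"
    by (simp add: weight_def card sum.distrib)
  finally show ?thesis .
qed

lemma W_subset: "W \<subseteq> V"
  by (auto simp: weight_centers_def)

lemma finite_W [simp]: "finite W"
  using finite_subset[OF W_subset finite_verts] .

lemma W_nonempty: "W \<noteq> {}"
proof -
  obtain v where "v \<in> V" "\<forall>u \<in> V. weight G v \<le> weight G u"
    using ex_min_if_finite[of "weight G ` V"] verts_nonempty finite_verts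
    by (metis (no_types, lifting) arg_min_if_finite(1) arg_min_least)
  then show ?thesis by (auto simp: weight_centers_def)
qed

lemma weight_center_majority:
  assumes "a \<in> W" "E a b"
  shows "card V \<le> 2 * card (side a b)"
proof -
  have "weight G a \<le> weight G b" using assms E_in_V by (auto simp: weight_centers_def)
  with weight_adjacent[OF assms(2)] card_side[OF assms(2)] show ?thesis by simp
qed

text \<open>
  If \<open>a\<close> and \<open>w\<close> were not adjacent, then with \<open>b\<close>, \<open>c\<close> the neighbours of \<open>a\<close>, \<open>w\<close> on the path between
  them, \<open>side a b\<close> and \<open>side w c\<close> would be disjoint and both avoid \<open>b\<close>, but each contains half of the
  vertices.
\<close>
lemma weight_centers_adjacent:
  assumes "a \<in> W" "w \<in> W" "a \<noteq> w"
  shows "E a w"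
proof (rule ccontr)
  assume "\<not> E a w"
  have V: "a \<in> V" "w \<in> V" using assms W_subset by auto
  have ne1: "d a w \<noteq> 1" using gdist_1_E[OF V] \<open>\<not> E a w\<close> by auto
  obtain b where b: "E a b" "d a w = Suc (d b w)" using gdist_first_step[OF V assms(3)] .
  obtain c where c: "E w c" "d w a = Suc (d c a)" using gdist_first_step[OF V(2,1)] assms(3) by metis
  have bV: "b \<in> V" using b E_in_V by auto
  have bw: "b \<noteq> w" using b ne1 V by auto
  have swap: "d w a = d a w" "d w b = d b w" "d b a = d a b" using gdist_sym V bV by auto
  have "b \<notin> side a b" using bV by (simp add: side_def)
  moreover have "b \<notin> side w c"
  proof -
    have "d w b + d b a = d w a" using swap b gdist_E[OF b(1)] by simp
    then have "d w b = Suc (d c b)" using first_step_between[OF c(1) V(1) c(2) bV bw] by simp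
    then show ?thesis using gdist_sym[of c b] swap c(1) E_in_V bV by (simp add: side_def)
  qed
  moreover have "side a b \<inter> side w c = {}"
  proof (rule ccontr)
    assume "side a b \<inter> side w c \<noteq> {}"
    then obtain u where u: "u \<in> V" "d u a < d u b" "d u w < d u c" by (auto simp: side_def)
    \<comment> \<open>If the median \<open>z\<close> were not \<open>a\<close>, the path from
      \<open>a\<close> to \<open>z\<close> would start with \<open>b\<close>, and \<open>b\<close>
      would be closer to \<open>u\<close> than \<open>a\<close> is. The same argument with
      \<open>c\<close> gives \<open>z = w\<close>.\<close>
    obtain z where z: "z \<in> V" "d a z + d z w = d a w" "d u z + d z a = d u a" "d u z + d z w = d u w"
      using median_exists[OF V u(1)] .
    have zsym: "d a z = d z a" "d w z = d z w" "d b z = d z b" "d c z = d z c"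
      using gdist_sym z(1) V bV c(1) E_in_V by auto
    have "z = a"
    proof (rule ccontr)
      assume "z \<noteq> a"
      then have "d a z = Suc (d b z)" using first_step_between[OF b(1) V(2) b(2) z(1)] z(2) by simp
      then show False using gdist_triangle[OF u(1) z(1) bV] u(2) z(3) zsym by simp
    qed
    moreover have "z = w"
    proof (rule ccontr)
      assume "z \<noteq> w"
      then have "d w z = Suc (d c z)"
        using first_step_between[OF c(1) V(1) c(2) z(1)] z(2) zsym swap by simp
      then show False using gdist_triangle[of u z c] u z zsym c(1) E_in_V by simp
    qed
    ultimately show False using assms(3) by simp
  qed
  ultimately have "card (side a b) + card (side w c) < card V"
    using card_Un_disjoint[of "side a b" "side w c"] bV side_subset
    by (metis (no_types, lifting) Un_iff finite_side finite_verts le_sup_iff psubset_card_mono psubsetI)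
  with weight_center_majority[OF assms(1) b(1)] weight_center_majority[OF assms(2) c(1)]
  show False by simp
qed

text \<open>Three centers would be pairwise adjacent, but no vertex of a tree is equidistant from
  the ends of an edge.\<close>

lemma weight_centers_cases:
  obtains (one) w where "W = {w}" | (two) a b where "W = {a, b}" "a \<noteq> b" "E a b"
proof -
  obtain a where a: "a \<in> W" using W_nonempty by auto
  show ?thesis
  proof (cases "W = {a}")
    case True
    then show ?thesis by (rule one)
  next
    case False
    then obtain b where b: "b \<in> W" "b \<noteq> a" using a by auto
    have "c = a \<or> c = b" if "c \<in> W" for c
    proof (rule ccontr)
      assume "\<not> (c = a \<or> c = b)"
      then have "E a b" "E c a" "E c b" using that a b weight_centers_adjacent by auto
      then show False using gdist_adjacent_neq[of a b c] gdist_E E_in_V by auto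
    qed
    then have "W = {a, b}" using a b by auto
    then show ?thesis using two weight_centers_adjacent a b by auto
  qed
qed

section \<open>Levels, ancestors and the distance formula\<close>

lemma level_le: "w \<in> W \<Longrightarrow> level G u \<le> d u w"
  unfolding level_def by (intro Min_le) auto

lemma level_attained:
  obtains w where "w \<in> W" "level G u = d u w"
proof -
  have "level G u \<in> d u ` W" unfolding level_def using W_nonempty by (intro Min_in) auto
  then show ?thesis using that by auto
qed

lemma level_eq_0_iff:
  assumes "u \<in> V"
  shows "level G u = 0 \<longleftrightarrow> u \<in> W"
proof
  assume "level G u = 0"
  then show "u \<in> W" using level_attained[of u] gdist_eq_0_iff assms W_subset by (metis subsetD)
next
  assume "u \<in> W"
  then show "level G u = 0" using level_le[of u u] assms by simp
qed

lemma ancestor_iff: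
  assumes "u \<in> V"
  shows "ancestor G z u \<longleftrightarrow> (\<exists>w \<in> W. d u w = level G u \<and> z \<in> V \<and> d u z + d z w = d u w)"
proof -
  have "ancestor G z u \<longleftrightarrow> (\<exists>w \<in> W. d u w = level G u \<and> (\<exists>q. apath u q w \<and> z \<in> set (awalk_verts u q)))"
    unfolding ancestor_def by (simp add: awalk_verts_with_proj_eq)
  also have "\<dots> \<longleftrightarrow> (\<exists>w \<in> W. d u w = level G u \<and> z \<in> V \<and> d u z + d z w = d u w)"
    using apath_through_iff[OF assms] W_subset by (intro bex_cong) auto
  finally show ?thesis .
qed

text \<open>The strict inequality makes \<open>w\<close> the only possible witness in the definition
  of ancestors; with a single weight center it is vacuous.\<close>

definition nearest :: "'a \<Rightarrow> 'a \<Rightarrow> bool" where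
  "nearest w u \<longleftrightarrow> w \<in> W \<and> u \<in> V \<and> (\<forall>w' \<in> W - {w}. d u w < d u w')"

lemma nearest_level: "nearest w u \<Longrightarrow> level G u = d u w"
  using level_attained[of u] level_le[of w u] unfolding nearest_def
  by (metis Diff_iff leD order_le_less singletonD)

lemma nearest_ancestor_iff:
  assumes "nearest w u"
  shows "ancestor G z u \<longleftrightarrow> z \<in> V \<and> d u z + d z w = d u w"
proof -
  have u: "u \<in> V" using assms by (simp add: nearest_def)
  have "w' = w" if "w' \<in> W" "d u w' = level G u" for w'
    using assms that nearest_level[OF assms]
    unfolding nearest_def by (metis Diff_iff nat_less_le singletonD)
  then show ?thesis
    unfolding ancestor_iff[OF u] using assms nearest_level[OF assms] by (auto simp: nearest_def)
qed

lemma nearest_of_between: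
  assumes "nearest w u" "z \<in> V" "d u z + d z w = d u w"
  shows "nearest w z"
  unfolding nearest_def
proof (intro conjI ballI)
  fix w' assume w': "w' \<in> W - {w}"
  then have "d u w < d u w'" "d u w' \<le> d u z + d z w'"
    using assms W_subset gdist_triangle by (auto simp: nearest_def)
  then show "d z w < d z w'" using assms(3) by simp
qed (use assms in \<open>auto simp: nearest_def\<close>)

text \<open>The distance from \<open>u\<close> to \<open>v\<close> is at most the distance through a
  common ancestor \<open>x\<close>, which is the sum of their levels minus twice the level of
  \<open>x\<close>. The median gives equality, so no common ancestor has a larger level.\<close>

lemma gdist_same_nearest:
  assumes "nearest w u" "nearest w v"
  shows "d u v + 2 * phi G u v = level G u + level G v"
proof -
  have V: "u \<in> V" "v \<in> V" "w \<in> V" using assms W_subset by (auto simp: nearest_def)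
  obtain z where z: "z \<in> V" "d u z + d z v = d u v" "d w z + d z u = d w u" "d w z + d z v = d w v"
    using median_exists[OF V] .
  have zs: "d w z = d z w" "d z u = d u z" "d w u = d u w" "d w v = d v w" "d z v = d v z"
    using gdist_sym V z(1) by auto
  let ?A = "{z \<in> V. ancestor G z u \<and> ancestor G z v}"
  have A: "?A = {z \<in> V. d u z + d z w = d u w \<and> d v z + d z w = d v w}"
    using nearest_ancestor_iff assms by auto
  have zA: "z \<in> ?A" unfolding A using z zs by simp
  have lev: "level G x = d x w" if "x \<in> ?A" for x
    using that assms(1) nearest_of_between nearest_level unfolding A by blast
  have "Max (level G ` ?A) = d z w"
  proof (rule Max_eqI)
    show "finite (level G ` ?A)" using finite_verts by simp
    show "d z w \<in> level G ` ?A" unfolding lev[OF zA, symmetric] by (rule imageI[OF zA])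
    fix y assume "y \<in> level G ` ?A"
    then obtain x where x: "x \<in> ?A" "y = d x w" using lev by auto
    then have "x \<in> V" by simp
    then have "d u v \<le> d u x + d x v" "d x v = d v x"
      using gdist_triangle[OF V(1) _ V(2)] gdist_sym[OF _ V(2)] by auto
    then show "y \<le> d z w" using x z zs unfolding A by simp
  qed
  then have "phi G u v = d z w" using zA by (auto simp: phi_def Let_def)
  then show ?thesis using z zs nearest_level assms by simp
qed

lemma side_nearest:
  assumes "W = {a, b}" "u \<in> side a b"
  shows "nearest a u"
  using assms by (auto simp: nearest_def side_def)

text \<open>The first step from \<open>a\<close> towards \<open>v\<close> is \<open>b\<close>, which
  is farther from \<open>u\<close>, so the geodesics from \<open>a\<close> to \<open>u\<close> and
  to \<open>v\<close> share no step.\<close>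

lemma gdist_across:
  assumes "E a b" "u \<in> side a b" "v \<in> side b a"
  shows "d u v = Suc (d u a + d v b)"
proof -
  have V: "u \<in> V" "v \<in> V" "a \<in> V" "b \<in> V" using assms side_subset E_in_V by auto
  have va: "d v a = Suc (d v b)" using side_cases[OF assms(1) V(2)] assms(3) by auto
  have "d u v = d u a + d a v"
  proof (rule gdist_add_of_no_common_step[OF V(1-3)])
    fix s assume s: "E a s" "d a u = Suc (d s u)" "d a v = Suc (d s v)"
    have "d a v = Suc (d b v)" using va gdist_sym V by simp
    then have "s = b" using first_step_unique[OF s(1) assms(1) V(2) s(3)] by blast
    then show False using s(2) assms(2) gdist_sym V by (simp add: side_def)
  qed
  then show ?thesis using va gdist_sym V by simp
qed

text \<open>A vertex between \<open>u\<close> and its nearest center has the same nearest center, so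
  a common ancestor would be strictly nearest to both centers. Hence \<phi> takes its default value
  0.\<close>

lemma phi_across:
  assumes "W = {a, b}" "u \<in> side a b" "v \<in> side b a"
  shows "phi G u v = 0"
proof -
  have n: "nearest a u" "nearest b v" using assms side_nearest by (auto simp: insert_commute)
  have "\<not> (ancestor G z u \<and> ancestor G z v)" for z
  proof
    assume "ancestor G z u \<and> ancestor G z v"
    then have "nearest a z" "nearest b z"
      using n nearest_ancestor_iff nearest_of_between by blast+
    moreover have "a \<noteq> b" using assms(2) by (auto simp: side_def)
    ultimately have "d z a < d z b" "d z b < d z a"
      using assms(1) by (auto simp: nearest_def)
    then show False by simp
  qed
  then show ?thesis by (simp add: phi_def)
qed

section \<open>The two components left by deleting the edge between the centers\<close>

text \<open>For an edge between the two sides \<open>gdist_across\<close> leaves distance 0 from its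
  ends to \<open>a\<close> and \<open>b\<close>, so it is the edge \<open>ab\<close> itself.\<close>

lemma remove_edge_side_invariant:
  assumes "E a b" "E x y" "x \<in> side a b" "(x, y) \<noteq> (a, b)"
  shows "y \<in> side a b"
proof (rule ccontr)
  have V: "x \<in> V" "y \<in> V" "a \<in> V" "b \<in> V" using assms E_in_V by auto
  assume "y \<notin> side a b"
  then have "y \<in> side b a" using side_cases[OF assms(1) V(2)] by auto
  then have "d x a = 0" "d y b = 0"
    using gdist_across[OF assms(1,3)] gdist_E[OF assms(2)] by auto
  then show False using assms(4) gdist_eq_0_iff V by auto
qed

lemma remove_edge_wf: "pair_wf_digraph (remove_edge G a b)"
  by unfold_locales (auto simp: remove_edge_def dest: wellformed')

lemma remove_edge_simps [simp]:
  "pverts (remove_edge G a b) = V"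
  "parcs (remove_edge G a b) = parcs G - {(a, b), (b, a)}"
  by (simp_all add: remove_edge_def)

text \<open>The geodesic to \<open>a\<close> never uses the deleted edge: its first step starts at a
  vertex other than \<open>a\<close> and \<open>b\<close> and stays on the same side.\<close>

lemma remove_edge_reaches_center:
  assumes "E a b" "u \<in> side a b"
  shows "u \<rightarrow>\<^sup>*\<^bsub>with_proj (remove_edge G a b)\<^esub> a \<and> a \<rightarrow>\<^sup>*\<^bsub>with_proj (remove_edge G a b)\<^esub> u"
  using assms(2)
proof (induction "d u a" arbitrary: u)
  interpret R: pair_wf_digraph "remove_edge G a b" by (rule remove_edge_wf)
  case 0
  then have "u = a" "a \<in> V" using gdist_eq_0_iff assms(1) E_in_V by (auto simp: side_def)
  then show ?case by auto
next
  interpret R: pair_wf_digraph "remove_edge G a b" by (rule remove_edge_wf)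
  case (Suc k)
  have V: "u \<in> V" "a \<in> V" "b \<in> V" using Suc.prems assms E_in_V by (auto simp: side_def)
  have "u \<noteq> a" using Suc.hyps(2) V by auto
  then obtain s where s: "E u s" "d u a = Suc (d s a)" using gdist_first_step V by blast
  have ub: "u \<noteq> b" using Suc.prems V by (auto simp: side_def)
  have "s \<in> side a b"
    using remove_edge_side_invariant[OF assms(1) s(1) Suc.prems] \<open>u \<noteq> a\<close> by auto
  then have IH: "s \<rightarrow>\<^sup>*\<^bsub>with_proj (remove_edge G a b)\<^esub> a" "a \<rightarrow>\<^sup>*\<^bsub>with_proj (remove_edge G a b)\<^esub> s"
    using Suc.hyps s by auto
  have arcs: "(u, s) \<in> parcs (remove_edge G a b)" "(s, u) \<in> parcs (remove_edge G a b)"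
    using s(1) E_sym[OF s(1)] ub \<open>u \<noteq> a\<close> by auto
  show ?case
    using R.adj_reachable_trans[OF arcs(1) IH(1)] R.reachable_adj_trans[OF IH(2) arcs(2)] by blast
qed

lemma remove_edge_reachable_iff:
  assumes "E a b" "u \<in> V" "v \<in> V"
  shows "u \<rightarrow>\<^sup>*\<^bsub>with_proj (remove_edge G a b)\<^esub> v \<longleftrightarrow> (u \<in> side a b \<longleftrightarrow> v \<in> side a b)"
proof
  interpret R: pair_wf_digraph "remove_edge G a b" by (rule remove_edge_wf)
  assume "u \<rightarrow>\<^sup>*\<^bsub>with_proj (remove_edge G a b)\<^esub> v"
  then show "u \<in> side a b \<longleftrightarrow> v \<in> side a b"
  proof (induction rule: R.reachable_induct)
    case (step x y)
    then have "E x y" "(x, y) \<noteq> (a, b)" "(y, x) \<noteq> (a, b)" by auto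
    then have "x \<in> side a b \<longleftrightarrow> y \<in> side a b"
      using remove_edge_side_invariant[OF assms(1)] E_sym by blast
    with step.IH show ?case by simp
  qed simp
next
  interpret R: pair_wf_digraph "remove_edge G a b" by (rule remove_edge_wf)
  have comm: "remove_edge G b a = remove_edge G a b"
    by (simp add: remove_edge_def insert_commute)
  assume same: "u \<in> side a b \<longleftrightarrow> v \<in> side a b"
  show "u \<rightarrow>\<^sup>*\<^bsub>with_proj (remove_edge G a b)\<^esub> v"
  proof (cases "u \<in> side a b")
    case True
    then show ?thesis
      using same remove_edge_reaches_center[OF assms(1)] R.reachable_trans by blast
  next
    case False
    then have "u \<in> side b a" "v \<in> side b a"
      using same side_cases[OF assms(1)] assms(2,3) by auto
    then show ?thesis
      using remove_edge_reaches_center[OF E_sym[OF assms(1)]] R.reachable_trans unfolding comm by blast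
  qed
qed

lemma delta_one_center:
  assumes "card W = 1"
  shows "delta G u v = 0"
proof -
  have "W \<noteq> {w, w'}" if "w \<noteq> w'" for w w'
    using assms that by auto
  then show ?thesis unfolding delta_def by auto
qed

lemma delta_two_centers:
  assumes "W = {a, b}" "E a b" "u \<in> V" "v \<in> V"
  shows "delta G u v = (if u \<in> side a b \<longleftrightarrow> v \<in> side a b then 0 else 1)"
proof -
  have comm: "remove_edge G b a = remove_edge G a b"
    by (simp add: remove_edge_def insert_commute)
  have "(\<exists>w w'. w \<noteq> w' \<and> W = {w, w'} \<and> \<not> u \<rightarrow>\<^sup>*\<^bsub>with_proj (remove_edge G w w')\<^esub> v)
    \<longleftrightarrow> \<not> u \<rightarrow>\<^sup>*\<^bsub>with_proj (remove_edge G a b)\<^esub> v"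
    using comm E_neq[OF assms(2)] unfolding assms(1) doubleton_eq_iff by metis
  then show ?thesis
    unfolding delta_def using remove_edge_reachable_iff[OF assms(2-4)] by simp
qed

lemma card_W_cases: "card W = 1 \<or> card W = 2"
  by (rule weight_centers_cases) auto

lemma gdist_phi_level_delta:
  assumes "u \<in> V" "v \<in> V"
  shows "d u v + 2 * phi G u v = level G u + level G v + delta G u v"
proof (cases rule: weight_centers_cases)
  case (one w)
  then have "nearest w u" "nearest w v" using assms by (auto simp: nearest_def)
  then show ?thesis using gdist_same_nearest delta_one_center one by simp
next
  case (two a b)
  note ba = two(1)[unfolded insert_commute[of a]]
  note dl = delta_two_centers[OF two(1,3) assms]
  consider "u \<in> side a b" "v \<in> side a b" | "u \<in> side b a" "v \<in> side b a"
    | "u \<in> side a b" "v \<in> side b a" | "u \<in> side b a" "v \<in> side a b"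
    using side_cases[OF two(3)] assms by blast
  then show ?thesis
  proof cases
    case 1
    then show ?thesis using gdist_same_nearest[OF side_nearest[OF two(1)] side_nearest[OF two(1)]] dl by simp
  next
    case 2
    then have "delta G u v = 0" using dl side_cases[OF two(3)] assms by auto
    then show ?thesis using 2 gdist_same_nearest[OF side_nearest[OF ba] side_nearest[OF ba]] by simp
  next
    case 3
    then have "delta G u v = 1" using dl side_cases[OF two(3)] assms by auto
    then show ?thesis
      using gdist_across[OF two(3) 3] phi_across[OF two(1) 3] 3
        nearest_level[OF side_nearest[OF two(1)]] nearest_level[OF side_nearest[OF ba]] by simp
  next
    case 4
    then have "delta G u v = 1" using dl side_cases[OF two(3)] assms by auto
    then show ?thesis
      using gdist_across[OF E_sym[OF two(3)] 4] phi_across[OF ba 4] 4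
        nearest_level[OF side_nearest[OF two(1)]] nearest_level[OF side_nearest[OF ba]] by simp
  qed
qed

text \<open>Each of the two centers has at least half of the vertices on its side, so each side is
  exactly one half.\<close>

lemma delta_bisection:
  assumes "card W = 2"
  obtains S where "S \<subseteq> V" "2 * card S = card V"
    "\<And>u v. u \<in> V \<Longrightarrow> v \<in> V \<Longrightarrow> delta G u v = (if u \<in> S \<longleftrightarrow> v \<in> S then 0 else 1)"
proof (cases rule: weight_centers_cases)
  case (two a b)
  have "card V \<le> 2 * card (side a b)" "card V \<le> 2 * card (side b a)"
    using weight_center_majority two E_sym by auto
  then have "2 * card (side a b) = card V" using card_side[OF two(3)] by simp
  then show ?thesis using that[of "side a b"] side_subset delta_two_centers[OF two(1,3)] by blast
qed (use assms in simp)

text \<open>With two centers \<delta> records a change of side, and changes of side add modulo 2;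
  with one center it vanishes.\<close>

lemma delta_two_steps:
  assumes "u \<in> V" "v \<in> V" "w \<in> V"
  shows "delta G u w = (if delta G u v = delta G v w then 0 else 1)"
proof (cases "card W = 1")
  case True
  then show ?thesis using delta_one_center by simp
next
  case False
  then have "card W = 2" using card_W_cases by simp
  then obtain S where
    "\<And>u v. u \<in> V \<Longrightarrow> v \<in> V \<Longrightarrow> delta G u v = (if u \<in> S \<longleftrightarrow> v \<in> S then 0 else 1)"
    by (rule delta_bisection) blast
  then show ?thesis using assms by simp
qed

end

lemma undirected_tree_utree:
  assumes "undirected_tree T"
  shows "utree T"
proof -
  interpret pair_graph T using assms by (simp add: undirected_tree_def)
  have conn: "Digraph_Component.connected (with_proj T)" and cyc: "\<not> (\<exists>q. cycle q \<and> 3 \<le> length q)"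
    using assms by (auto simp: undirected_tree_def)
  show ?thesis
  proof
    show "pverts T \<noteq> {}"
      using conn by (auto simp: connected_def strongly_connected_def)
    fix u v assume uv: "u \<in> pverts T" "v \<in> pverts T"
    then have "u \<rightarrow>\<^sup>*\<^bsub>with_proj T\<^esub> v"
      using conn sym_arcs reachable_mk_symmetric_eq by (auto simp: connected_def strongly_connected_def)
    then have "(u, v) \<in> (parcs T)\<^sup>*" by (auto dest: reachable_rtranclI)
    then show "\<exists>k. (u, v) \<in> parcs T ^^ k" by (rule rtrancl_imp_relpow[THEN exE]) blast
  qed (use cyc in force)
qed

section \<open>The Cartesian product of two trees\<close>

lemma cart_prod_simps [simp]:
  "pverts (cart_prod T1 T2) = pverts T1 \<times> pverts T2"
  "((x, y), (x', y')) \<in> parcs (cart_prod T1 T2) \<longleftrightarrow>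
     (x = x' \<and> x \<in> pverts T1 \<and> (y, y') \<in> parcs T2) \<or>
     (y = y' \<and> y \<in> pverts T2 \<and> (x, x') \<in> parcs T1)"
  by (auto simp: cart_prod_def)

lemma cart_prod_relpow_fst:
  assumes "(x, x') \<in> parcs T1 ^^ k" "y \<in> pverts T2"
  shows "((x, y), (x', y)) \<in> parcs (cart_prod T1 T2) ^^ k"
  using assms(1)
proof (induction k arbitrary: x')
  case (Suc k)
  then obtain s where "(x, s) \<in> parcs T1 ^^ k" "(s, x') \<in> parcs T1" by auto
  with Suc.IH assms(2) show ?case by (intro relpow_Suc_I[of _ "(s, y)"]) auto
qed simp

lemma cart_prod_relpow_snd:
  assumes "(y, y') \<in> parcs T2 ^^ k" "x \<in> pverts T1"
  shows "((x, y), (x, y')) \<in> parcs (cart_prod T1 T2) ^^ k"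
  using assms(1)
proof (induction k arbitrary: y')
  case (Suc k)
  then obtain s where "(y, s) \<in> parcs T2 ^^ k" "(s, y') \<in> parcs T2" by auto
  with Suc.IH assms(2) show ?case by (intro relpow_Suc_I[of _ "(x, s)"]) auto
qed simp

text \<open>Each step in the product moves exactly one coordinate; \<open>i\<close> and
  \<open>j\<close> count the moves in each.\<close>

lemma cart_prod_relpow_split:
  assumes "((x, y), z') \<in> parcs (cart_prod T1 T2) ^^ k"
  shows "\<exists>i j. k = i + j \<and> (x, fst z') \<in> parcs T1 ^^ i \<and> (y, snd z') \<in> parcs T2 ^^ j"
  using assms
proof (induction k arbitrary: z')
  case (Suc k)
  then obtain s where s: "((x, y), s) \<in> parcs (cart_prod T1 T2) ^^ k" "(s, z') \<in> parcs (cart_prod T1 T2)"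
    by auto
  obtain i j where ij: "k = i + j" "(x, fst s) \<in> parcs T1 ^^ i" "(y, snd s) \<in> parcs T2 ^^ j"
    using Suc.IH[OF s(1)] by blast
  consider "fst s = fst z'" "(snd s, snd z') \<in> parcs T2" | "snd s = snd z'" "(fst s, fst z') \<in> parcs T1"
    using s(2) by (cases s; cases z') auto
  then show ?case
  proof cases
    case 1
    then show ?thesis using ij by (intro exI[of _ i] exI[of _ "Suc j"]) (auto intro: relpow_Suc_I)
  next
    case 2
    then show ?thesis using ij by (intro exI[of _ "Suc i"] exI[of _ j]) (auto intro: relpow_Suc_I)
  qed
qed auto

lemma connected_pair_graph_cart_prod:
  assumes "connected_pair_graph T1" "connected_pair_graph T2"
  shows "connected_pair_graph (cart_prod T1 T2)"
proof -
  interpret T1: connected_pair_graph T1 by fact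
  interpret T2: connected_pair_graph T2 by fact
  have sub: "parcs (cart_prod T1 T2) \<subseteq> (pverts T1 \<times> pverts T2) \<times> (pverts T1 \<times> pverts T2)"
    using T1.wellformed' T2.wellformed' by auto
  show ?thesis
  proof
    show "finite (pverts (cart_prod T1 T2))" using T1.finite_verts T2.finite_verts by simp
    then show "finite (parcs (cart_prod T1 T2))" using finite_subset[OF sub] by simp
    show "pverts (cart_prod T1 T2) \<noteq> {}" using T1.verts_nonempty T2.verts_nonempty by simp
    show "symmetric (with_proj (cart_prod T1 T2))"
      unfolding symmetric_def with_proj_simps
      by (rule symI) (auto dest: T1.E_sym T2.E_sym)
    fix e assume e: "e \<in> parcs (cart_prod T1 T2)"
    then show "fst e \<in> pverts (cart_prod T1 T2)" "snd e \<in> pverts (cart_prod T1 T2)"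
      using sub by auto
    show "fst e \<noteq> snd e"
      using e by (cases e) (auto dest: T1.E_neq T2.E_neq)
  next
    fix u v assume "u \<in> pverts (cart_prod T1 T2)" "v \<in> pverts (cart_prod T1 T2)"
    then obtain x y x' y' where xy: "u = (x, y)" "v = (x', y')" "x \<in> pverts T1" "y \<in> pverts T2"
      "x' \<in> pverts T1" "y' \<in> pverts T2" by auto
    obtain i j where "(x, x') \<in> parcs T1 ^^ i" "(y, y') \<in> parcs T2 ^^ j"
      using T1.relpow_connected T2.relpow_connected xy by blast
    then have "(u, v) \<in> parcs (cart_prod T1 T2) ^^ (i + j)"
      using cart_prod_relpow_fst[of x x' i T1 y T2] cart_prod_relpow_snd[of y y' j T2 x' T1] xy
      by (auto simp: relpow_add)
    then show "\<exists>k. (u, v) \<in> parcs (cart_prod T1 T2) ^^ k" by blast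
  qed
qed

lemma gdist_cart_prod:
  assumes "connected_pair_graph T1" "connected_pair_graph T2"
    and "u \<in> pverts T1 \<times> pverts T2" "v \<in> pverts T1 \<times> pverts T2"
  shows "gdist (cart_prod T1 T2) u v = gdist T1 (fst u) (fst v) + gdist T2 (snd u) (snd v)"
proof -
  interpret T1: connected_pair_graph T1 by fact
  interpret T2: connected_pair_graph T2 by fact
  interpret P: connected_pair_graph "cart_prod T1 T2"
    using connected_pair_graph_cart_prod assms(1,2) .
  obtain x y x' y' where xy: "u = (x, y)" "v = (x', y')" "x \<in> pverts T1" "y \<in> pverts T2"
    "x' \<in> pverts T1" "y' \<in> pverts T2" using assms(3,4) by auto
  show ?thesis
  proof (rule antisym)
    have "(u, v) \<in> parcs (cart_prod T1 T2) ^^ (gdist T1 x x' + gdist T2 y y')"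
      using cart_prod_relpow_fst[OF T1.gdist_relpow, of x x' y T2]
        cart_prod_relpow_snd[OF T2.gdist_relpow, of y y' x' T1] xy
      by (auto simp: relpow_add)
    then show "gdist (cart_prod T1 T2) u v \<le> gdist T1 (fst u) (fst v) + gdist T2 (snd u) (snd v)"
      using P.gdist_le xy by simp
    have "(u, v) \<in> parcs (cart_prod T1 T2) ^^ gdist (cart_prod T1 T2) u v"
      using P.gdist_relpow assms(3,4) by simp
    from cart_prod_relpow_split[OF this[unfolded xy(1)]]
    obtain i j where "gdist (cart_prod T1 T2) u v = i + j"
      "(x, x') \<in> parcs T1 ^^ i" "(y, y') \<in> parcs T2 ^^ j"
      unfolding xy by auto
    then show "gdist T1 (fst u) (fst v) + gdist T2 (snd u) (snd v) \<le> gdist (cart_prod T1 T2) u v"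
      using T1.gdist_le T2.gdist_le xy by (simp add: add_mono)
  qed
qed

lemma gdiam_cart_prod:
  assumes "connected_pair_graph T1" "connected_pair_graph T2"
  shows "gdiam (cart_prod T1 T2) = gdiam T1 + gdiam T2"
proof (rule antisym)
  interpret T1: connected_pair_graph T1 by fact
  interpret T2: connected_pair_graph T2 by fact
  interpret P: connected_pair_graph "cart_prod T1 T2"
    using connected_pair_graph_cart_prod assms .
  note dist = gdist_cart_prod[OF assms]
  obtain u v where "u \<in> pverts (cart_prod T1 T2)" "v \<in> pverts (cart_prod T1 T2)"
    "gdist (cart_prod T1 T2) u v = gdiam (cart_prod T1 T2)" using P.gdiam_attained .
  then show "gdiam (cart_prod T1 T2) \<le> gdiam T1 + gdiam T2"
    using dist[of u v] T1.gdist_le_gdiam T2.gdist_le_gdiam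
    by (metis add_mono cart_prod_simps(1) mem_Times_iff)
  obtain x x' where x: "x \<in> pverts T1" "x' \<in> pverts T1" "gdist T1 x x' = gdiam T1"
    using T1.gdiam_attained .
  obtain y y' where y: "y \<in> pverts T2" "y' \<in> pverts T2" "gdist T2 y y' = gdiam T2"
    using T2.gdiam_attained .
  show "gdiam T1 + gdiam T2 \<le> gdiam (cart_prod T1 T2)"
    using dist[of "(x, y)" "(x', y')"] P.gdist_le_gdiam[of "(x, y)" "(x', y')"] x y by simp
qed

locale tree_pair =
  T1: utree T1 + T2: utree T2
  for T1 :: "'a pair_pre_digraph" and T2 :: "'b pair_pre_digraph" +
  assumes diam1: "2 \<le> gdiam T1" and diam2: "2 \<le> gdiam T2"
begin

sublocale P: connected_pair_graph "cart_prod T1 T2"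
  using connected_pair_graph_cart_prod T1.connected_pair_graph_axioms T2.connected_pair_graph_axioms .

abbreviation V :: "('a \<times> 'b) set" where "V \<equiv> pverts T1 \<times> pverts T2"
definition p :: nat where "p = card V"
abbreviation \<xi> :: nat where "\<xi> \<equiv> xi T1 T2"
abbreviation diam :: nat where "diam \<equiv> gdiam T1 + gdiam T2"
abbreviation L :: "'a \<times> 'b \<Rightarrow> nat" where "L \<equiv> prod_level T1 T2"
abbreviation \<phi> :: "'a \<times> 'b \<Rightarrow> 'a \<times> 'b \<Rightarrow> nat" where "\<phi> \<equiv> prod_phi T1 T2"
abbreviation \<delta> :: "'a \<times> 'b \<Rightarrow> 'a \<times> 'b \<Rightarrow> nat" where "\<delta> \<equiv> prod_delta T1 T2"
abbreviation D :: "'a \<times> 'b \<Rightarrow> 'a \<times> 'b \<Rightarrow> nat" where "D \<equiv> gdist (cart_prod T1 T2)"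

lemma finite_V [simp]: "finite V"
  using P.finite_verts by simp

lemma D_formula:
  assumes "u \<in> V" "v \<in> V"
  shows "D u v + 2 * \<phi> u v = L u + L v + \<delta> u v"
  using gdist_cart_prod[OF T1.connected_pair_graph_axioms T2.connected_pair_graph_axioms assms]
    T1.gdist_phi_level_delta[of "fst u" "fst v"] T2.gdist_phi_level_delta[of "snd u" "snd v"] assms
  by (auto simp: prod_phi_def prod_level_def prod_delta_def)

lemma diam_eq: "gdiam (cart_prod T1 T2) = diam"
  using gdiam_cart_prod T1.connected_pair_graph_axioms T2.connected_pair_graph_axioms .

lemma D_le: "u \<in> V \<Longrightarrow> v \<in> V \<Longrightarrow> D u v \<le> diam"
  using P.gdist_le_gdiam diam_eq by simp

lemma two_le_card_verts: "2 \<le> card (pverts T1)" "2 \<le> card (pverts T2)"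
proof -
  obtain x x' where x: "x \<in> pverts T1" "x' \<in> pverts T1" "gdist T1 x x' = gdiam T1"
    using T1.gdiam_attained .
  have "x \<noteq> x'" using x diam1 by auto
  then have "card {x, x'} = 2" by simp
  then show "2 \<le> card (pverts T1)" using x card_mono[OF T1.finite_verts, of "{x, x'}"] by simp
  obtain y y' where y: "y \<in> pverts T2" "y' \<in> pverts T2" "gdist T2 y y' = gdiam T2"
    using T2.gdiam_attained .
  have "y \<noteq> y'" using y diam2 by auto
  then have "card {y, y'} = 2" by simp
  then show "2 \<le> card (pverts T2)" using y card_mono[OF T2.finite_verts, of "{y, y'}"] by simp
qed

lemma four_le_p: "4 \<le> p"
  using mult_le_mono[OF two_le_card_verts] by (simp add: p_def card_cartesian_product)

lemma centers_cases:
  obtains (one) "card T1.W = 1" "card T2.W = 1" "\<xi> = 0" "card (prod_weight_centers T1 T2) = 1"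
  | (two) "card T1.W * card T2.W = 2" "\<xi> = 1" "card (prod_weight_centers T1 T2) = 2"
  | (four) "card T1.W = 2" "card T2.W = 2" "\<xi> = 2" "card (prod_weight_centers T1 T2) = 4"
  using T1.card_W_cases T2.card_W_cases
  by (auto simp: xi_def prod_weight_centers_def card_cartesian_product)

lemma card_centers_4_iff: "card (prod_weight_centers T1 T2) = 4 \<longleftrightarrow> \<xi> = 2"
  by (rule centers_cases) auto

lemma \<delta>_le: "u \<in> V \<Longrightarrow> v \<in> V \<Longrightarrow> \<delta> u v \<le> \<xi>"
proof -
  have "delta T1 (fst u) (fst v) \<le> card T1.W - 1" "delta T2 (snd u) (snd v) \<le> card T2.W - 1"
    using T1.delta_one_center T2.delta_one_center T1.card_W_cases T2.card_W_cases
    by (auto simp: delta_def)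
  then show ?thesis
    using T1.card_W_cases T2.card_W_cases by (auto simp: prod_delta_def xi_def)
qed

lemma L_eq_0_iff: "u \<in> V \<Longrightarrow> L u = 0 \<longleftrightarrow> u \<in> prod_weight_centers T1 T2"
  using T1.level_eq_0_iff[of "fst u"] T2.level_eq_0_iff[of "snd u"]
  by (auto simp: prod_level_def prod_weight_centers_def mem_Times_iff)

text \<open>
  Two steps with \<open>\<delta> = 2\<close> return to the same quarter of the vertex set. Hence such steps never leave
  a pair of opposite quarters, that is, one half of the vertex set.
\<close>
lemma opposite_quarters:
  assumes "\<xi> = 2"
  obtains S where "\<And>u v. u \<in> V \<Longrightarrow> v \<in> V \<Longrightarrow> \<delta> u v = 2 \<Longrightarrow> u \<in> S \<longleftrightarrow> v \<in> S"
    "\<And>u v. u \<in> V \<Longrightarrow> v \<in> V \<Longrightarrow> \<delta> u v = 1 \<Longrightarrow> u \<in> S \<longleftrightarrow> v \<notin> S"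
    "card {u \<in> V. u \<in> S} = p div 2" "card {u \<in> V. u \<notin> S} = p div 2"
proof -
  have c: "card T1.W = 2" "card T2.W = 2" by (rule centers_cases; use assms in simp)+
  obtain A where A: "A \<subseteq> pverts T1" "2 * card A = card (pverts T1)"
    "\<And>u v. u \<in> pverts T1 \<Longrightarrow> v \<in> pverts T1 \<Longrightarrow> delta T1 u v = (if u \<in> A \<longleftrightarrow> v \<in> A then 0 else 1)"
    by (rule T1.delta_bisection[OF c(1)]) blast
  obtain B where B: "B \<subseteq> pverts T2" "2 * card B = card (pverts T2)"
    "\<And>u v. u \<in> pverts T2 \<Longrightarrow> v \<in> pverts T2 \<Longrightarrow> delta T2 u v = (if u \<in> B \<longleftrightarrow> v \<in> B then 0 else 1)"
    by (rule T2.delta_bisection[OF c(2)]) blast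
  \<comment> \<open>\<delta> counts the coordinates that change halves. Membership in
    \<open>S\<close> is the parity of the two choices of half: changing both keeps it, changing one
    reverses it.\<close>
  define S where "S = {u. fst u \<in> A \<longleftrightarrow> snd u \<in> B}"
  have fin: "finite A" "finite B" using A B finite_subset T1.finite_verts T2.finite_verts by blast+
  have comp: "card (pverts T1 - A) = card A" "card (pverts T2 - B) = card B"
    using A B fin by (auto simp: card_Diff_subset)
  have "{u \<in> V. u \<in> S} = A \<times> B \<union> (pverts T1 - A) \<times> (pverts T2 - B)"
    using A(1) B(1) by (auto simp: S_def)
  then have "card {u \<in> V. u \<in> S} = card (A \<times> B) + card ((pverts T1 - A) \<times> (pverts T2 - B))"
    using fin T1.finite_verts T2.finite_verts by (simp only:) (rule card_Un_disjoint, auto)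
  also have "\<dots> = 2 * (card A * card B)" by (simp add: card_cartesian_product comp)
  also have "\<dots> = p div 2"
    unfolding p_def card_cartesian_product A(2)[symmetric] B(2)[symmetric] by simp
  finally have cS: "card {u \<in> V. u \<in> S} = p div 2" .
  have "{u \<in> V. u \<notin> S} = V - {u \<in> V. u \<in> S}" by auto
  then have "card {u \<in> V. u \<notin> S} = p - p div 2" using cS by (simp add: card_Diff_subset p_def)
  moreover have "even p" unfolding p_def card_cartesian_product A(2)[symmetric] by simp
  ultimately have cS': "card {u \<in> V. u \<notin> S} = p div 2" by (auto elim: evenE)
  show ?thesis
    by (rule that[OF _ _ cS cS'])
      (auto simp: prod_delta_def S_def A(3) B(3) split: if_splits)
qed

section \<open>The cost of an ordering and the orderings of minimal cost\<close>

abbreviation ordering :: "(nat \<Rightarrow> 'a \<times> 'b) \<Rightarrow> bool" where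
  "ordering z \<equiv> bij_betw z {0..<p} V"

lemma ordering_in_V: "ordering z \<Longrightarrow> t < p \<Longrightarrow> z t \<in> V"
  using bij_betwE by fastforce

lemma ordering_inj: "ordering z \<Longrightarrow> s < p \<Longrightarrow> t < p \<Longrightarrow> z s = z t \<longleftrightarrow> s = t"
  by (auto dest: bij_betw_imp_inj_on intro: inj_onD)

text \<open>The excess of the required label difference over its value for a step with \<phi> = 0
  and \<delta> = \<xi>. On vertices the subtraction does not truncate, by
  \<open>\<delta>_le\<close>.\<close>

definition step_cost :: "(nat \<Rightarrow> 'a \<times> 'b) \<Rightarrow> nat \<Rightarrow> nat" where
  "step_cost z t = 2 * \<phi> (z t) (z (Suc t)) + (\<xi> - \<delta> (z t) (z (Suc t)))"

text \<open>As a number, the exception in the notion of feasible ordering enters sums, and every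
  step satisfies the same equation \<delta> + \<open>exceptional\<close> = \<xi>.\<close>

definition exceptional :: "nat \<Rightarrow> nat" where
  "exceptional t = (if \<xi> = 2 \<and> t = p div 2 - 1 then 1 else 0)"

text \<open>The summand 1 in the first and third formulas for the radio number.\<close>

definition min_cost :: nat where
  "min_cost = (if \<xi> = 1 then 0 else 1)"

lemma feasible_ordering_iff:
  "feasible_ordering T1 T2 z \<longleftrightarrow>
     ordering z \<and> (\<forall>t < p - 1. \<phi> (z t) (z (Suc t)) = 0 \<and> \<delta> (z t) (z (Suc t)) + exceptional t = \<xi>)"
proof -
  have 1: "t + 1 < p \<longleftrightarrow> t < p - 1" for t by auto
  have 2: "(if \<xi> = 2 \<and> t = p div 2 - 1 then a = 0 \<and> b = 1 else a = 0 \<and> b = \<xi>) \<longleftrightarrow>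
      a = 0 \<and> b + exceptional t = \<xi>" for t a b :: nat
    by (auto simp: exceptional_def)
  show ?thesis
    unfolding feasible_ordering_def Let_def feasible_def card_centers_4_iff cart_prod_simps p_def[symmetric]
      2 1 by simp
qed

text \<open>A step cost of at most 1 forces \<phi> = 0, since \<phi> enters it with factor 2; what
  remains is \<xi> - \<delta>.\<close>

lemma feasible_ordering_iff_step_cost:
  "feasible_ordering T1 T2 z \<longleftrightarrow> ordering z \<and> (\<forall>t < p - 1. step_cost z t = exceptional t)"
proof -
  have "(\<phi> (z t) (z (Suc t)) = 0 \<and> \<delta> (z t) (z (Suc t)) + exceptional t = \<xi>) \<longleftrightarrow>
      step_cost z t = exceptional t" if "ordering z" "t < p - 1" for t
  proof -
    have "\<delta> (z t) (z (Suc t)) \<le> \<xi>" using that ordering_in_V by (intro \<delta>_le) auto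
    moreover have "exceptional t \<le> 1" by (simp add: exceptional_def)
    ultimately show ?thesis unfolding step_cost_def by presburger
  qed
  then show ?thesis unfolding feasible_ordering_iff by blast
qed

definition cost :: "(nat \<Rightarrow> 'a \<times> 'b) \<Rightarrow> nat" where
  "cost z = L (z 0) + L (z (p - 1)) + (\<Sum>t < p - 1. step_cost z t)"

text \<open>A cost of 1 means \<delta> = 1, so membership in \<open>S\<close> changes once, between
  positions \<open>s\<close> and \<open>s + 1\<close>. Thus the first \<open>s + 1\<close> vertices
  are exactly the half containing the initial vertex.\<close>

lemma single_exception_in_the_middle:
  assumes "\<xi> = 2" "ordering z" "s < p - 1" "step_cost z s = 1"
    and "\<And>t. t < p - 1 \<Longrightarrow> t \<noteq> s \<Longrightarrow> step_cost z t = 0"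
  shows "s = p div 2 - 1"
proof -
  obtain S where S: "\<And>u v. u \<in> V \<Longrightarrow> v \<in> V \<Longrightarrow> \<delta> u v = 2 \<Longrightarrow> u \<in> S \<longleftrightarrow> v \<in> S"
    "\<And>u v. u \<in> V \<Longrightarrow> v \<in> V \<Longrightarrow> \<delta> u v = 1 \<Longrightarrow> u \<in> S \<longleftrightarrow> v \<notin> S"
    "card {u \<in> V. u \<in> S} = p div 2" "card {u \<in> V. u \<notin> S} = p div 2"
    by (rule opposite_quarters[OF assms(1)]) blast
  have same: "(z t \<in> S \<longleftrightarrow> z 0 \<in> S) \<longleftrightarrow> t \<le> s" if "t < p" for t
    using that
  proof (induction t)
    case (Suc t)
    have V: "z t \<in> V" "z (Suc t) \<in> V" using Suc.prems assms(2) ordering_in_V by auto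
    show ?case
    proof (cases "t = s")
      case True
      then have "\<delta> (z t) (z (Suc t)) = 1"
        using assms(1,4) unfolding step_cost_def by presburger
      then show ?thesis using S(2)[OF V] Suc True by auto
    next
      case False
      then have "\<delta> (z t) (z (Suc t)) = 2"
        using assms(1) assms(5)[of t, OF less_diff_conv[THEN iffD2]] Suc.prems False \<delta>_le[OF V]
        by (auto simp: step_cost_def)
      then show ?thesis using S(1)[OF V] Suc False by auto
    qed
  qed simp
  have "z ` {t. t < p \<and> t \<le> s} = {u \<in> V. u \<in> S \<longleftrightarrow> z 0 \<in> S}"
  proof (intro equalityI subsetI)
    fix u assume "u \<in> {u \<in> V. u \<in> S \<longleftrightarrow> z 0 \<in> S}"
    then obtain t where "t < p" "u = z t" "z t \<in> S \<longleftrightarrow> z 0 \<in> S"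
      using assms(2) unfolding bij_betw_def
      by (metis (mono_tags, lifting) atLeastLessThan_iff imageE mem_Collect_eq)
    then show "u \<in> z ` {t. t < p \<and> t \<le> s}" using same by blast
  next
    fix u assume "u \<in> z ` {t. t < p \<and> t \<le> s}"
    then show "u \<in> {u \<in> V. u \<in> S \<longleftrightarrow> z 0 \<in> S}" using same ordering_in_V[OF assms(2)] by blast
  qed
  moreover have "{t. t < p \<and> t \<le> s} = {..s}" using assms(3) by auto
  moreover have "inj_on z {..s}" using assms(2,3) by (auto simp: bij_betw_def inj_on_def)
  ultimately have "Suc s = card {u \<in> V. u \<in> S \<longleftrightarrow> z 0 \<in> S}" by (metis card_atMost card_image)
  also have "\<dots> = p div 2" using S(3,4) by (cases "z 0 \<in> S") auto
  finally show ?thesis by simp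
qed

text \<open>With \<delta> = 2 in every step the ordering would stay in one half and miss the other,
  which is nonempty.\<close>

lemma total_step_cost_pos:
  assumes "\<xi> = 2" "ordering z"
  shows "(\<Sum>t < p - 1. step_cost z t) \<noteq> 0"
proof
  assume "(\<Sum>t < p - 1. step_cost z t) = 0"
  then have zero: "step_cost z t = 0" if "t < p - 1" for t using that by simp
  obtain S where S: "\<And>u v. u \<in> V \<Longrightarrow> v \<in> V \<Longrightarrow> \<delta> u v = 2 \<Longrightarrow> u \<in> S \<longleftrightarrow> v \<in> S"
    "card {u \<in> V. u \<in> S} = p div 2" "card {u \<in> V. u \<notin> S} = p div 2"
    by (rule opposite_quarters[OF assms(1)]) blast
  have same: "z t \<in> S \<longleftrightarrow> z 0 \<in> S" if "t < p" for t
    using that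
  proof (induction t)
    case (Suc t)
    have V: "z t \<in> V" "z (Suc t) \<in> V" using Suc.prems assms(2) ordering_in_V by auto
    have "\<delta> (z t) (z (Suc t)) = 2"
      using assms(1) zero[of t, OF less_diff_conv[THEN iffD2]] Suc.prems \<delta>_le[OF V]
      by (auto simp: step_cost_def)
    then show ?case using S(1)[OF V] Suc by auto
  qed simp
  have "u \<in> S \<longleftrightarrow> z 0 \<in> S" if u: "u \<in> V" for u
  proof -
    have "u \<in> z ` {0..<p}" using u assms(2) by (simp only: bij_betw_def)
    then obtain t where t: "t < p" "u = z t" by auto
    show ?thesis unfolding t(2) by (rule same[OF t(1)])
  qed
  then have "{u \<in> V. u \<in> S} = {} \<or> {u \<in> V. u \<notin> S} = {}" by blast
  then have "card {u \<in> V. u \<in> S} = 0 \<or> card {u \<in> V. u \<notin> S} = 0"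
    by (elim disjE) (simp_all only: card.empty simp_thms)
  then show False using S(2,3) four_le_p by auto
qed

lemma end_levels_pos:
  assumes "\<xi> = 0" "ordering z"
  shows "L (z 0) + L (z (p - 1)) \<noteq> 0"
proof
  have V: "z 0 \<in> V" "z (p - 1) \<in> V" using ordering_in_V[OF assms(2)] four_le_p by simp_all
  have one: "card (prod_weight_centers T1 T2) = 1" by (rule centers_cases; use assms(1) in simp)
  assume "L (z 0) + L (z (p - 1)) = 0"
  then have "z 0 \<in> prod_weight_centers T1 T2" "z (p - 1) \<in> prod_weight_centers T1 T2"
    using L_eq_0_iff[OF V(1)] L_eq_0_iff[OF V(2)] by simp_all
  then have "z 0 = z (p - 1)" using one by (metis card_1_singletonE singletonD)
  then show False using ordering_inj[OF assms(2), of 0 "p - 1"] four_le_p by auto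
qed

lemma min_cost_le_cost:
  assumes "ordering z"
  shows "min_cost \<le> cost z"
proof (cases rule: centers_cases)
  case one
  then show ?thesis
    using end_levels_pos[OF _ assms] by (simp add: min_cost_def cost_def Suc_le_eq trans_less_add1)
next
  case four
  show ?thesis
    using total_step_cost_pos[OF four(3) assms] unfolding min_cost_def cost_def by presburger
qed (simp add: min_cost_def)

text \<open>For \<xi> = 0 the end levels alone cost at least 1, for \<xi> = 2 the steps alone do.
  Equality therefore fixes both summands separately, and for \<xi> = 2 exactly one step costs
  1.\<close>

lemma cost_eq_min_cost_iff:
  assumes "ordering z"
  shows "cost z = min_cost \<longleftrightarrow> feasible_ordering T1 T2 z \<and> end_level_condition T1 T2 z"
proof -
  let ?s = "\<Sum>t < p - 1. step_cost z t" and ?e = "L (z 0) + L (z (p - 1))"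
  have f: "feasible_ordering T1 T2 z \<longleftrightarrow> (\<forall>t < p - 1. step_cost z t = exceptional t)"
    using feasible_ordering_iff_step_cost assms by simp
  have e: "end_level_condition T1 T2 z \<longleftrightarrow> ?e = (if \<xi> = 0 then 1 else 0)"
    by (cases rule: centers_cases) (auto simp: end_level_condition_def Let_def p_def simp del: card_cartesian_product)
  show ?thesis
  proof (cases rule: centers_cases)
    case one
    have "?e \<noteq> 0" using end_levels_pos[OF one(3) assms] .
    then have "cost z = min_cost \<longleftrightarrow> ?e = 1 \<and> ?s = 0"
      using one(3) unfolding cost_def min_cost_def by presburger
    then show ?thesis using f e one by (auto simp: exceptional_def)
  next
    case two
    then have "cost z = min_cost \<longleftrightarrow> ?e = 0 \<and> ?s = 0"
      unfolding cost_def min_cost_def by presburger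
    then show ?thesis using f e two by (auto simp: exceptional_def)
  next
    case four
    have "cost z = min_cost \<longleftrightarrow> ?e = 0 \<and> ?s = 1"
      using total_step_cost_pos[OF four(3) assms] four(3) unfolding cost_def min_cost_def by presburger
    moreover have "?s = 1 \<longleftrightarrow> (\<forall>t < p - 1. step_cost z t = exceptional t)"
    proof
      assume "?s = 1"
      then have "\<exists>s \<in> {..<p - 1}. step_cost z s = 1 \<and> (\<forall>t \<in> {..<p - 1}. s \<noteq> t \<longrightarrow> step_cost z t = 0)"
        by (subst (asm) sum_eq_1_iff) simp_all
      then obtain s where s: "s < p - 1" "step_cost z s = 1"
        "\<And>t. t < p - 1 \<Longrightarrow> t \<noteq> s \<Longrightarrow> step_cost z t = 0"
        by (metis lessThan_iff)
      then have "s = p div 2 - 1" using single_exception_in_the_middle[OF four(3) assms] by blast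
      then show "\<forall>t < p - 1. step_cost z t = exceptional t"
        using s four by (auto simp: exceptional_def)
    next
      assume "\<forall>t < p - 1. step_cost z t = exceptional t"
      then have "?s = (\<Sum>t < p - 1. if t = p div 2 - 1 then 1 else 0)"
        using four by (intro sum.cong) (auto simp: exceptional_def)
      also have "\<dots> = 1" using four_le_p by simp
      finally show "?s = 1" .
    qed
    ultimately show ?thesis using f e four by auto
  qed
qed

end

lemma sum_consecutive_pairs:
  fixes g :: "nat \<Rightarrow> int"
  shows "(\<Sum>t < q. g t + g (Suc t)) = 2 * (\<Sum>t < Suc q. g t) - g 0 - g q"
  by (induction q) auto

lemma sum_differences:
  fixes g :: "nat \<Rightarrow> int"
  shows "(\<Sum>t < q. g (Suc t) - g t) = g q - g 0"
  by (induction q) auto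

context tree_pair
begin

section \<open>The lower bound for the span\<close>

abbreviation G :: "('a \<times> 'b) pair_pre_digraph" where "G \<equiv> cart_prod T1 T2"

definition step_length :: "(nat \<Rightarrow> 'a \<times> 'b) \<Rightarrow> nat \<Rightarrow> int" where
  "step_length z t = int diam + 1 - int (D (z t) (z (Suc t)))"

text \<open>The three values in the theorem as one formula, the cases being absorbed by \<xi> and
  \<open>min_cost\<close>.\<close>

definition span_bound :: int where
  "span_bound = (int p - 1) * (int diam + 1 - int \<xi>)
     - 2 * int (card (pverts T2)) * int (total_level T1)
     - 2 * int (card (pverts T1)) * int (total_level T2) + int min_cost"

lemma sum_L:
  assumes "ordering z"
  shows "(\<Sum>t < p. int (L (z t))) =
    int (card (pverts T2)) * int (total_level T1) + int (card (pverts T1)) * int (total_level T2)"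
proof -
  have "(\<Sum>t < p. int (L (z t))) = (\<Sum>v \<in> V. int (L v))"
    using sum.reindex_bij_betw[OF assms, of "\<lambda>v. int (L v)"] by (simp add: atLeast0LessThan)
  also have "\<dots> = (\<Sum>x \<in> pverts T1. \<Sum>y \<in> pverts T2. int (level T1 x) + int (level T2 y))"
    by (simp add: sum.cartesian_product prod_level_def case_prod_unfold)
  finally show ?thesis
    by (simp add: sum.distrib total_level_def flip: sum_distrib_left)
qed

lemma sum_step_length:
  assumes "ordering z"
  shows "(\<Sum>t < p - 1. step_length z t) = span_bound + int (cost z) - int min_cost"
proof -
  have "step_length z t = (int diam + 1 - int \<xi>) - (int (L (z t)) + int (L (z (Suc t))))
      + int (step_cost z t)" if "t < p - 1" for t
  proof -
    have V: "z t \<in> V" "z (Suc t) \<in> V" using assms ordering_in_V that by simp_all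
    show ?thesis
      using D_formula[OF V] \<delta>_le[OF V] unfolding step_length_def step_cost_def by linarith
  qed
  then have "(\<Sum>t < p - 1. step_length z t) = (\<Sum>t < p - 1. (int diam + 1 - int \<xi>)
      - (int (L (z t)) + int (L (z (Suc t)))) + int (step_cost z t))" by simp
  also have "\<dots> = int (p - 1) * (int diam + 1 - int \<xi>)
      - (\<Sum>t < p - 1. int (L (z t)) + int (L (z (Suc t)))) + (\<Sum>t < p - 1. int (step_cost z t))"
    by (simp add: sum.distrib sum_subtractf)
  also have "(\<Sum>t < p - 1. int (L (z t)) + int (L (z (Suc t)))) =
      2 * (\<Sum>t < p. int (L (z t))) - int (L (z 0)) - int (L (z (p - 1)))"
    using sum_consecutive_pairs[of "\<lambda>t. int (L (z t))" "p - 1"] four_le_p by simp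
  finally show ?thesis
    using four_le_p unfolding sum_L[OF assms] span_bound_def cost_def by (simp add: of_nat_diff)
qed

lemma radio_labelingD:
  assumes "radio_labeling G f"
  shows "v \<in> V \<Longrightarrow> 0 \<le> f v"
    and "u \<in> V \<Longrightarrow> v \<in> V \<Longrightarrow> u \<noteq> v \<Longrightarrow> int diam + 1 - int (D u v) \<le> \<bar>f u - f v\<bar>"
  using assms unfolding radio_labeling_def cart_prod_simps(1) diam_eq by blast+

text \<open>Distances do not exceed the diameter, so every constraint demands a difference of at
  least 1 and all labels are distinct.\<close>

lemma sorted_ordering:
  assumes "radio_labeling G f"
  obtains z where "ordering z" "\<And>i j. i < j \<Longrightarrow> j < p \<Longrightarrow> f (z i) < f (z j)"
proof -
  let ?g = "\<lambda>v. nat (f v)"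
  note nonneg = radio_labelingD(1)[OF assms]
  have inj: "inj_on ?g V"
  proof (rule inj_onI, rule ccontr)
    fix u v assume uv: "u \<in> V" "v \<in> V" "?g u = ?g v" "u \<noteq> v"
    then have "f u = f v" using nonneg[of u] nonneg[of v] by simp
    moreover have "\<bar>f u - f v\<bar> \<ge> int diam + 1 - int (D u v)"
      using radio_labelingD(2)[OF assms] uv by blast
    ultimately show False using D_le[OF uv(1,2)] by simp
  qed
  have card: "card (?g ` V) = p" using card_image[OF inj] by (simp add: p_def)
  obtain h where h: "bij_betw h {..<p} (?g ` V)" "strict_mono_on {..<p} h"
    using ex_bij_betw_strict_mono_card[of "?g ` V"] card by auto
  define z where "z = inv_into V ?g \<circ> h"
  have "bij_betw (inv_into V ?g) (?g ` V) V"
    by (rule bij_betw_inv_into) (simp add: bij_betw_def inj)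
  then have "bij_betw z {..<p} V" unfolding z_def using h(1) by (rule bij_betw_trans[rotated])
  then have z: "ordering z" by (simp add: atLeast0LessThan)
  have gz: "?g (z i) = h i" if "i < p" for i
  proof -
    have "h i \<in> ?g ` V" using h(1) that by (auto simp: bij_betw_def)
    then show ?thesis unfolding z_def comp_def by (rule f_inv_into_f)
  qed
  show ?thesis
  proof (rule that[OF z])
    fix i j assume ij: "i < j" "j < p"
    then have "?g (z i) < ?g (z j)"
      using gz[of i] gz[of j] h(2) by (simp add: strict_mono_on_def)
    then show "f (z i) < f (z j)" by simp
  qed
qed

lemma label_span_eq:
  assumes "ordering z" "\<And>i j. i < j \<Longrightarrow> j < p \<Longrightarrow> f (z i) < f (z j)"
  shows "label_span G f = f (z (p - 1)) - f (z 0)"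
proof -
  have im: "f ` V = (\<lambda>i. f (z i)) ` {0..<p}"
    using assms(1) by (metis bij_betw_imp_surj_on image_image)
  have le: "f (z i) \<le> f (z j)" if "i \<le> j" "j < p" for i j
    using assms(2)[of i j] that by (cases "i = j") auto
  have "Max (f ` V) = f (z (p - 1))"
    unfolding im using le four_le_p by (intro Max_eqI) auto
  moreover have "Min (f ` V) = f (z 0)"
    unfolding im using le four_le_p by (intro Min_eqI) auto
  ultimately show ?thesis by (simp add: label_span_def)
qed

text \<open>With \<open>gap\<close> the slack in a consecutive constraint, the span is
  \<open>span_bound\<close> plus the excess of the cost over \<open>min_cost\<close> plus all gaps.
  The added terms are nonnegative, so they vanish if the bound is attained.\<close>

lemma span_lower_bound:
  assumes "radio_labeling G f"
  shows "span_bound \<le> label_span G f"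
    and "label_span G f = span_bound \<Longrightarrow>
      \<exists>z. ordering z \<and> cost z = min_cost \<and> (\<forall>t < p - 1. f (z (Suc t)) = f (z t) + step_length z t)"
proof -
  obtain z where z: "ordering z" "\<And>i j. i < j \<Longrightarrow> j < p \<Longrightarrow> f (z i) < f (z j)"
    by (rule sorted_ordering[OF assms]) blast
  define gap where "gap t = f (z (Suc t)) - f (z t) - step_length z t" for t
  have gap: "0 \<le> gap t" if t: "t < p - 1" for t
  proof -
    have V: "z t \<in> V" "z (Suc t) \<in> V" using z(1) ordering_in_V t by simp_all
    have less: "f (z t) < f (z (Suc t))" using z(2)[of t "Suc t"] t by simp
    then have "z t \<noteq> z (Suc t)" by auto
    then have "\<bar>f (z t) - f (z (Suc t))\<bar> \<ge> step_length z t"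
      using radio_labelingD(2)[OF assms V] by (simp add: step_length_def)
    then show ?thesis using less by (simp add: gap_def)
  qed
  have "label_span G f = (\<Sum>t < p - 1. f (z (Suc t)) - f (z t))"
    using label_span_eq[OF z(1), of f] z(2) sum_differences[of "\<lambda>t. f (z t)"] by simp
  also have "\<dots> = (\<Sum>t < p - 1. step_length z t) + (\<Sum>t < p - 1. gap t)"
    by (simp add: gap_def flip: sum.distrib)
  finally have span: "label_span G f =
      span_bound + (int (cost z) - int min_cost) + (\<Sum>t < p - 1. gap t)"
    using sum_step_length[OF z(1)] by simp
  have gaps: "0 \<le> (\<Sum>t < p - 1. gap t)" using gap by (intro sum_nonneg) simp
  have c: "int min_cost \<le> int (cost z)" using min_cost_le_cost[OF z(1)] by simp
  show "span_bound \<le> label_span G f" using span gaps c by linarith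
  assume "label_span G f = span_bound"
  then have "cost z = min_cost" and g0: "(\<Sum>t < p - 1. gap t) = 0" using span gaps c by linarith+
  moreover have "f (z (Suc t)) = f (z t) + step_length z t" if "t < p - 1" for t
    using sum_nonneg_0[of "{..<p - 1}" gap t] g0 gap that by (simp add: gap_def)
  ultimately show "\<exists>z. ordering z \<and> cost z = min_cost \<and>
      (\<forall>t < p - 1. f (z (Suc t)) = f (z t) + step_length z t)"
    using z(1) by blast
qed

text \<open>Distinct multiples of the diameter plus 1 satisfy every constraint. Existence ensures
  that the \<open>LEAST\<close> defining the radio number is attained.\<close>

lemma radio_labeling_exists: "\<exists>f. radio_labeling G f"
proof -
  obtain h :: "'a \<times> 'b \<Rightarrow> nat" where h: "inj_on h V"
    using finite_imp_inj_to_nat_seg[OF finite_V] by blast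
  have "radio_labeling G (\<lambda>v. (int diam + 1) * int (h v))"
    unfolding radio_labeling_def
  proof (intro conjI ballI impI)
    fix u v assume uv: "u \<in> pverts G" "v \<in> pverts G" "u \<noteq> v"
    then have "h u \<noteq> h v" using h by (auto dest: inj_onD)
    then have "1 \<le> \<bar>int (h u) - int (h v)\<bar>" by simp
    then have "int diam + 1 \<le> (int diam + 1) * \<bar>int (h u) - int (h v)\<bar>"
      using mult_left_mono[of 1 _ "int diam + 1"] by simp
    also have "\<dots> = \<bar>(int diam + 1) * int (h u) - (int diam + 1) * int (h v)\<bar>"
      by (simp add: abs_mult flip: right_diff_distrib)
    finally show "int (gdiam G) + 1 - int (gdist G u v)
        \<le> \<bar>(int diam + 1) * int (h u) - (int diam + 1) * int (h v)\<bar>"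
      using diam_eq by simp
  qed simp
  then show ?thesis by blast
qed

lemma label_span_nonneg: "radio_labeling G f \<Longrightarrow> 0 \<le> label_span G f"
proof -
  assume "radio_labeling G f"
  then obtain z where z: "ordering z" "\<And>i j. i < j \<Longrightarrow> j < p \<Longrightarrow> f (z i) < f (z j)"
    using sorted_ordering by blast
  have "f (z 0) < f (z (p - 1))" using z(2) four_le_p by simp
  then show ?thesis using label_span_eq[OF z(1), of f] z(2) by simp
qed

lemma radio_number_attained:
  obtains f where "radio_labeling G f" "label_span G f = int (radio_number G)"
proof -
  obtain f where f: "radio_labeling G f" using radio_labeling_exists by blast
  have "\<exists>k f. radio_labeling G f \<and> label_span G f = int k"
    using f label_span_nonneg[OF f] zero_le_imp_eq_int by blast
  then have "\<exists>f. radio_labeling G f \<and> label_span G f = int (radio_number G)"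
    unfolding radio_number_def by (rule LeastI_ex)
  then show ?thesis using that by blast
qed

lemma radio_number_eq_span_bound:
  assumes "radio_labeling G f" "label_span G f = span_bound"
  shows "int (radio_number G) = span_bound"
proof (rule antisym)
  obtain k where k: "span_bound = int k"
    using label_span_nonneg[OF assms(1)] assms(2) zero_le_imp_eq_int by auto
  have "radio_number G \<le> k"
    unfolding radio_number_def by (rule Least_le) (use assms k in auto)
  then show "int (radio_number G) \<le> span_bound" using k by simp
  show "span_bound \<le> int (radio_number G)"
    using radio_number_attained span_lower_bound(1) by metis
qed

section \<open>Labelings with minimal steps\<close>

text \<open>The recursion in the theorem without its initial value, so that it also covers a given
  optimal labeling, whose least label may be positive.\<close>

definition tight :: "(nat \<Rightarrow> 'a \<times> 'b) \<Rightarrow> ('a \<times> 'b \<Rightarrow> int) \<Rightarrow> bool" where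
  "tight z f \<longleftrightarrow> (\<forall>t < p - 1. f (z (Suc t)) = f (z t) + int diam + 1
     - int (L (z t)) - int (L (z (Suc t))) - int (\<delta> (z t) (z (Suc t))))"

text \<open>The number of exceptional steps between positions \<open>a\<close> and \<open>b\<close>,
  that is, the sum of \<open>exceptional t\<close> over \<open>a \<le> t < b\<close>.\<close>

definition passes_middle :: "nat \<Rightarrow> nat \<Rightarrow> nat" where
  "passes_middle a b = (if \<xi> = 2 \<and> a \<le> p div 2 - 1 \<and> p div 2 \<le> b then 1 else 0)"

definition pair_bound :: "(nat \<Rightarrow> 'a \<times> 'b) \<Rightarrow> nat \<Rightarrow> nat \<Rightarrow> bool" where
  "pair_bound z a b \<longleftrightarrow> int diam + 1 + 2 * int (\<phi> (z a) (z b)) \<le>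
     (int b - int a) * (int diam + 1 - int \<xi>) - 2 * (\<Sum>t \<in> {a<..<b}. int (L (z t)))
     + int (passes_middle a b) + int (\<delta> (z a) (z b))"

lemma step_length_feasible:
  assumes "feasible_ordering T1 T2 z" "t < p - 1"
  shows "step_length z t =
    int diam + 1 - int (L (z t)) - int (L (z (Suc t))) - int (\<delta> (z t) (z (Suc t)))"
proof -
  have o: "ordering z" and ph: "\<phi> (z t) (z (Suc t)) = 0"
    using assms feasible_ordering_iff by auto
  have "z t \<in> V" "z (Suc t) \<in> V" using o ordering_in_V assms(2) by simp_all
  from D_formula[OF this] show ?thesis unfolding step_length_def ph by linarith
qed

lemma tight_iff:
  assumes "feasible_ordering T1 T2 z"
  shows "tight z f \<longleftrightarrow> (\<forall>t < p - 1. f (z (Suc t)) = f (z t) + step_length z t)"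
proof -
  have "x = y + int diam + 1 - int (L (z t)) - int (L (z (Suc t))) - int (\<delta> (z t) (z (Suc t)))
      \<longleftrightarrow> x = y + step_length z t" if "t < p - 1" for t x y
    unfolding step_length_feasible[OF assms that] by auto
  then show ?thesis unfolding tight_def by blast
qed

lemma tight_strict_mono:
  assumes "feasible_ordering T1 T2 z" "tight z f" "a < b" "b < p"
  shows "f (z a) < f (z b)"
  using assms(3,4)
proof (induction b)
  case (Suc b)
  have o: "ordering z" using assms(1) feasible_ordering_iff by auto
  have "z b \<in> V" "z (Suc b) \<in> V" using o ordering_in_V Suc.prems by simp_all
  then have "0 < step_length z b" unfolding step_length_def using D_le by fastforce
  then have "f (z b) < f (z (Suc b))" using assms(2) tight_iff[OF assms(1)] Suc.prems by simp
  then show ?case using Suc by (cases "a = b") auto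
qed simp

text \<open>Telescoping: inner levels occur in two steps, the levels at \<open>a\<close> and
  \<open>b\<close> in one, and each step has \<delta> = \<xi> except for the exceptional
  one.\<close>

lemma tight_difference:
  assumes "feasible_ordering T1 T2 z" "tight z f" "a < b" "b < p"
  shows "f (z b) - f (z a) = (int b - int a) * (int diam + 1 - int \<xi>) - int (L (z a)) - int (L (z b))
    - 2 * (\<Sum>t \<in> {a<..<b}. int (L (z t))) + int (passes_middle a b)"
  using assms(3,4)
proof (induction b)
  case (Suc b)
  have "\<delta> (z b) (z (Suc b)) + exceptional b = \<xi>"
    using assms(1) Suc.prems feasible_ordering_iff by auto
  then have step: "f (z (Suc b)) - f (z b) = int diam + 1 - int \<xi> - int (L (z b)) - int (L (z (Suc b)))
      + int (exceptional b)"
    using assms(2) Suc.prems unfolding tight_def by (auto simp flip: of_nat_add)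
  show ?case
  proof (cases "a = b")
    case True
    have "passes_middle a (Suc a) = exceptional a"
      using four_le_p by (auto simp: passes_middle_def exceptional_def)
    moreover have "{a<..<Suc a} = {}" by auto
    ultimately show ?thesis using step True by simp
  next
    case False
    then have ab: "a < b" using Suc.prems by simp
    have "{a<..<Suc b} = insert b {a<..<b}" using ab by auto
    then have "(\<Sum>t \<in> {a<..<Suc b}. int (L (z t))) = int (L (z b)) + (\<Sum>t \<in> {a<..<b}. int (L (z t)))"
      by simp
    moreover have "passes_middle a (Suc b) = passes_middle a b + exceptional b"
      using ab four_le_p by (auto simp: passes_middle_def exceptional_def)
    ultimately show ?thesis using step Suc.IH[OF ab] Suc.prems by (simp add: algebra_simps)
  qed
qed simp

lemma tight_radio_iff:
  assumes "feasible_ordering T1 T2 z" "tight z f" "0 \<le> f (z 0)"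
  shows "radio_labeling G f \<longleftrightarrow> (\<forall>a b. a < b \<and> b < p \<longrightarrow> pair_bound z a b)"
proof -
  have o: "ordering z" using assms(1) feasible_ordering_iff by auto
  have pair: "\<bar>f (z b) - f (z a)\<bar> \<ge> int (gdiam G) + 1 - int (D (z a) (z b)) \<longleftrightarrow> pair_bound z a b"
    if ab: "a < b" "b < p" for a b
  proof -
    have V: "z a \<in> V" "z b \<in> V" using o ordering_in_V ab by simp_all
    show ?thesis
      using D_formula[OF V] tight_difference[OF assms(1,2) ab] tight_strict_mono[OF assms(1,2) ab]
      unfolding pair_bound_def diam_eq by linarith
  qed
  show ?thesis
  proof
    assume f: "radio_labeling G f"
    show "\<forall>a b. a < b \<and> b < p \<longrightarrow> pair_bound z a b"
    proof (intro allI impI)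
      fix a b assume ab: "a < b \<and> b < p"
      then have "z a \<in> V" "z b \<in> V" "z b \<noteq> z a"
        using o ordering_in_V ordering_inj by auto
      then show "pair_bound z a b"
        using f pair[of a b] ab P.gdist_sym unfolding radio_labeling_def cart_prod_simps by metis
    qed
  next
    assume pb: "\<forall>a b. a < b \<and> b < p \<longrightarrow> pair_bound z a b"
    have idx: "\<exists>i < p. v = z i" if "v \<in> V" for v
      using that o unfolding bij_betw_def by force
    show "radio_labeling G f"
      unfolding radio_labeling_def cart_prod_simps
    proof (intro conjI ballI impI)
      fix v assume "v \<in> V"
      then obtain i where "i < p" "v = z i" using idx by blast
      then show "0 \<le> f v" using tight_strict_mono[OF assms(1,2), of 0 i] assms(3) by (cases "i = 0") auto
    next
      fix u v assume uv: "u \<in> V" "v \<in> V" "u \<noteq> v"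
      obtain i where i: "i < p" "u = z i" using uv idx by blast
      obtain j where j: "j < p" "v = z j" using uv idx by blast
      consider "i < j" | "j < i" using uv i j by fastforce
      then show "int (gdiam G) + 1 - int (D u v) \<le> \<bar>f u - f v\<bar>"
      proof cases
        case 1
        then show ?thesis using pair[of i j] pb i j by (simp add: abs_minus_commute)
      next
        case 2
        then show ?thesis using pair[of j i] pb i j P.gdist_sym[of u v] uv by simp
      qed
    qed
  qed
qed

lemma tight_exists:
  assumes "ordering z"
  obtains f where "tight z f" "f (z 0) = 0"
proof -
  define g where "g i = (\<Sum>t < i. int diam + 1
     - int (L (z t)) - int (L (z (Suc t))) - int (\<delta> (z t) (z (Suc t))))" for i
  define f where "f v = g (inv_into {0..<p} z v)" for v
  have f: "f (z i) = g i" if "i < p" for i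
    using assms that unfolding f_def by (simp add: bij_betw_def)
  have "tight z f" unfolding tight_def using f by (auto simp: g_def)
  moreover have "f (z 0) = 0" using f[of 0] four_le_p by (simp add: g_def)
  ultimately show ?thesis by (rule that)
qed

lemma tight_label_span:
  assumes "feasible_ordering T1 T2 z" "end_level_condition T1 T2 z" "tight z f"
  shows "label_span G f = span_bound"
proof -
  have o: "ordering z" using assms(1) feasible_ordering_iff by auto
  have "label_span G f = (\<Sum>t < p - 1. f (z (Suc t)) - f (z t))"
    using label_span_eq[OF o, of f] tight_strict_mono[OF assms(1,3)]
      sum_differences[of "\<lambda>t. f (z t)"] by simp
  also have "\<dots> = (\<Sum>t < p - 1. step_length z t)"
    using assms(3) tight_iff[OF assms(1)] by (intro sum.cong) auto
  finally show ?thesis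
    using sum_step_length[OF o] cost_eq_min_cost_iff[OF o] assms(1,2) by simp
qed

section \<open>The conditions on levels and common ancestors\<close>

lemma level_bound_condition_iff:
  "level_bound_condition T1 T2 z \<longleftrightarrow> (\<forall>s < p. 2 * int (L (z s)) \<le>
     int diam + 1 - 2 * int \<xi> + (if \<xi> = 2 \<and> (s = p div 2 - 1 \<or> s = p div 2) then 2 else 0))"
proof -
  have 1: "real l \<le> (if Q then (real k + 3 - 2 * real x) / 2 else (real k + 1 - 2 * real x) / 2) \<longleftrightarrow>
    2 * int l \<le> int k + 1 - 2 * int x + (if Q then 2 else 0)" for l k x Q
    by auto
  show ?thesis
    unfolding level_bound_condition_def Let_def cart_prod_simps p_def[symmetric] card_centers_4_iff
      insert_iff empty_iff 1 by simp
qed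

lemma pair_bound_iff:
  "pair_bound z a b \<longleftrightarrow> real (\<phi> (z a) (z b)) \<le>
     (real b - real a - 1) * ((real diam + 1 - real \<xi>) / 2) - (\<Sum>t \<in> {a<..<b}. real (L (z t)))
     - (real \<xi> - real (\<delta> (z a) (z b)) - real (passes_middle a b)) / 2"
proof -
  have "pair_bound z a b \<longleftrightarrow> real_of_int (int diam + 1 + 2 * int (\<phi> (z a) (z b))) \<le> real_of_int (
     (int b - int a) * (int diam + 1 - int \<xi>) - 2 * (\<Sum>t \<in> {a<..<b}. int (L (z t)))
     + int (passes_middle a b) + int (\<delta> (z a) (z b)))"
    unfolding pair_bound_def of_int_le_iff ..
  also have "\<dots> \<longleftrightarrow> real diam + 1 + 2 * real (\<phi> (z a) (z b)) \<le>
     (real b - real a) * (real diam + 1 - real \<xi>) - 2 * (\<Sum>t \<in> {a<..<b}. real (L (z t)))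
     + real (passes_middle a b) + real (\<delta> (z a) (z b))"
    by simp
  also have "\<dots> \<longleftrightarrow> real (\<phi> (z a) (z b)) \<le>
     (real b - real a - 1) * ((real diam + 1 - real \<xi>) / 2) - (\<Sum>t \<in> {a<..<b}. real (L (z t)))
     - (real \<xi> - real (\<delta> (z a) (z b)) - real (passes_middle a b)) / 2"
  proof -
    \<comment> \<open>One copy of \<open>c\<close> leaves the product. With \<open>a\<close> the
      diameter and \<open>c\<close> = \<open>a + 1 - \<xi>\<close>, the constant
      \<open>a + 1 - c\<close> is \<xi>, which explains the factor b - a - 1 and the \<xi> in
      (c).\<close>
    have "a + 1 + 2 * f \<le> k * c - 2 * S + e + y \<longleftrightarrow>
        f \<le> (k - 1) * (c / 2) - S - (a + 1 - c - y - e) / 2" for a f k c S e y :: real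
      by (auto simp: field_simps)
    from this[of "real diam" _ _ "real diam + 1 - real \<xi>"] show ?thesis by (simp add: diff_diff_eq2)
  qed
  finally show ?thesis .
qed

lemma phi_bound_condition_iff:
  "phi_bound_condition T1 T2 z \<longleftrightarrow>
     (\<forall>a b. a < b \<and> b < p \<and> \<not> feasible T1 T2 (z a) (z b) \<longrightarrow> pair_bound z a b)"
proof -
  have 1: "(if \<xi> = 2 \<and> {p div 2 - 1, p div 2} \<subseteq> {a..b} then (x - y - 1) / 2 else (x - y) / 2) =
      (x - y - real (passes_middle a b)) / 2" if "a < b" for a b and x y :: real
    using that by (auto simp: passes_middle_def)
  show ?thesis
    unfolding phi_bound_condition_def Let_def cart_prod_simps p_def[symmetric] card_centers_4_iff
      pair_bound_iff of_nat_add[symmetric]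
    by (intro all_cong1 imp_cong refl) (simp only: 1)
qed

text \<open>The inner levels are at most (d + 1 - \<xi>)/2 even at the two middle positions: for
  \<xi> = 2 the exceptional bound d + 3 - 2\<xi> equals d + 1 - \<xi>.\<close>

lemma pair_bound_of_feasible:
  assumes "level_bound_condition T1 T2 z" "a < b" "b < p" "feasible T1 T2 (z a) (z b)"
  shows "pair_bound z a b"
proof -
  have \<xi>: "\<xi> \<le> 2" by (cases rule: centers_cases) auto
  have "2 * int (L (z t)) \<le> int diam + 1 - int \<xi>" if "t \<in> {a<..<b}" for t
  proof -
    have "2 * int (L (z t)) \<le> int diam + 1 - 2 * int \<xi> + (if \<xi> = 2 then 2 else 0)"
      using assms(1,3) that level_bound_condition_iff[of z] by (smt (verit) greaterThanLessThan_iff less_trans)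
    then show ?thesis using \<xi> by (auto split: if_splits)
  qed
  then have "(\<Sum>t \<in> {a<..<b}. 2 * int (L (z t))) \<le> int (card {a<..<b}) * (int diam + 1 - int \<xi>)"
    by (rule sum_bounded_above)
  also have "int (card {a<..<b}) = int b - int a - 1" using assms(2) by (simp add: of_nat_diff)
  finally have "2 * (\<Sum>t \<in> {a<..<b}. int (L (z t))) \<le> (int b - int a - 1) * (int diam + 1 - int \<xi>)"
    by (simp add: sum_distrib_left)
  moreover have "\<phi> (z a) (z b) = 0" "\<delta> (z a) (z b) = \<xi>" using assms(4) by (auto simp: feasible_def)
  ultimately show ?thesis unfolding pair_bound_def by (simp add: algebra_simps)
qed

text \<open>Two full steps change the half of each two-centered coordinate twice. If the two values
  add up to 3, one step changes both coordinates and the other just one, and the latter coordinate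
  returns to its half.\<close>

lemma \<delta>_two_steps:
  assumes "u \<in> V" "v \<in> V" "w \<in> V"
  shows "\<delta> u v = \<xi> \<Longrightarrow> \<delta> v w = \<xi> \<Longrightarrow> \<delta> u w = 0"
    and "\<xi> = 2 \<Longrightarrow> \<delta> u v + \<delta> v w = 3 \<Longrightarrow> \<delta> u w \<le> 1"
proof -
  have V: "fst u \<in> pverts T1" "fst v \<in> pverts T1" "fst w \<in> pverts T1"
    "snd u \<in> pverts T2" "snd v \<in> pverts T2" "snd w \<in> pverts T2" using assms by auto
  have le: "delta T1 x x' \<le> card T1.W - 1" "delta T2 y y' \<le> card T2.W - 1" for x x' y y'
    using T1.delta_one_center T2.delta_one_center T1.card_W_cases T2.card_W_cases
    by (auto simp: delta_def)
  have \<xi>: "\<xi> = (card T1.W - 1) + (card T2.W - 1)"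
    using T1.card_W_cases T2.card_W_cases by (auto simp: xi_def)
  note two = T1.delta_two_steps[OF V(1-3)] T2.delta_two_steps[OF V(4-6)]
  {
    assume "\<delta> u v = \<xi>" "\<delta> v w = \<xi>"
    then have "delta T1 (fst u) (fst v) = delta T1 (fst v) (fst w)"
      "delta T2 (snd u) (snd v) = delta T2 (snd v) (snd w)"
      using le(1)[of "fst u" "fst v"] le(2)[of "snd u" "snd v"] le(1)[of "fst v" "fst w"]
        le(2)[of "snd v" "snd w"]
      unfolding \<xi> prod_delta_def by linarith+
    then show "\<delta> u w = 0" using two by (simp add: prod_delta_def)
  }
  {
    assume "\<xi> = 2" "\<delta> u v + \<delta> v w = 3"
    then have "delta T1 (fst u) (fst v) = delta T1 (fst v) (fst w) \<or>
      delta T2 (snd u) (snd v) = delta T2 (snd v) (snd w)"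
      using le(1)[of "fst u" "fst v"] le(2)[of "snd u" "snd v"] le(1)[of "fst v" "fst w"]
        le(2)[of "snd v" "snd w"]
      unfolding \<xi> prod_delta_def by linarith
    then show "\<delta> u w \<le> 1" using two by (auto simp: prod_delta_def)
  }
qed

lemma level_bound_of_pair_bounds:
  assumes z: "feasible_ordering T1 T2 z" "end_level_condition T1 T2 z"
    and pb: "\<And>a b. a < b \<Longrightarrow> b < p \<Longrightarrow> pair_bound z a b"
  shows "level_bound_condition T1 T2 z"
  unfolding level_bound_condition_iff
proof (intro allI impI)
  fix s assume s: "s < p"
  have o: "ordering z" using z(1) feasible_ordering_iff by auto
  have d4: "4 \<le> diam" using diam1 diam2 by simp
  show "2 * int (L (z s)) \<le>
     int diam + 1 - 2 * int \<xi> + (if \<xi> = 2 \<and> (s = p div 2 - 1 \<or> s = p div 2) then 2 else 0)"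
  proof (cases "s = 0 \<or> s = p - 1")
    case True
    have "L (z 0) + L (z (p - 1)) = (if \<xi> = 0 then 1 else 0)" "\<xi> \<le> 2"
      using z(2) by (cases rule: centers_cases;
        simp add: end_level_condition_def Let_def p_def del: card_cartesian_product)+
    \<comment> \<open>By (a) an end vertex has level at most 1, and level 0 unless \<xi> = 0, so the
      bound only needs the diameter to be large enough.\<close>
    then show ?thesis using True d4 by (auto split: if_splits)
  next
    case False
    then obtain r where r: "s = Suc r" "Suc s < p" using s by (cases s) auto
    have V: "z r \<in> V" "z s \<in> V" "z (Suc s) \<in> V" using r o ordering_in_V by simp_all
    have steps: "\<delta> (z r) (z s) + exceptional r = \<xi>" "\<delta> (z s) (z (Suc s)) + exceptional s = \<xi>"
      using z(1) r unfolding feasible_ordering_iff by auto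
    have "{r<..<Suc s} = {s}" using r by auto
    then have "int diam + 1 \<le> 2 * (int diam + 1 - int \<xi>) - 2 * int (L (z s))
        + int (passes_middle r (Suc s)) + int (\<delta> (z r) (z (Suc s)))"
      using pb[of r "Suc s"] r unfolding pair_bound_def by simp
    moreover have "passes_middle r (Suc s) + \<delta> (z r) (z (Suc s))
        \<le> (if \<xi> = 2 \<and> (s = p div 2 - 1 \<or> s = p div 2) then 2 else 0)"
    proof (cases "\<xi> = 2 \<and> (s = p div 2 - 1 \<or> s = p div 2)")
      case True
      \<comment> \<open>The middle step leaves \<open>z s\<close> if \<open>s = p div 2 - 1\<close>
        and enters it if \<open>s = p div 2\<close>. The other step is full, so the two values of
        \<delta> add up to 3.\<close>
      then have "exceptional r + exceptional s = 1"
        using r four_le_p by (auto simp: exceptional_def)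
      then have "\<delta> (z r) (z (Suc s)) \<le> 1"
        using steps True by (intro \<delta>_two_steps(2)[OF V]) linarith+
      then show ?thesis using True by (simp add: passes_middle_def)
    next
      case False
      then have "exceptional r = 0" "exceptional s = 0" "passes_middle r (Suc s) = 0"
        using r four_le_p by (auto simp: exceptional_def passes_middle_def)
      then show ?thesis using steps \<delta>_two_steps(1)[OF V] by simp
    qed
    ultimately show ?thesis by (auto split: if_splits)
  qed
qed

lemma pair_bounds_iff:
  assumes "feasible_ordering T1 T2 z" "end_level_condition T1 T2 z"
  shows "(\<forall>a b. a < b \<and> b < p \<longrightarrow> pair_bound z a b) \<longleftrightarrow>
    level_bound_condition T1 T2 z \<and> phi_bound_condition T1 T2 z"
  using level_bound_of_pair_bounds[OF assms] pair_bound_of_feasible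
  unfolding phi_bound_condition_iff by blast

lemma tight_optimal:
  assumes "feasible_ordering T1 T2 z" "end_level_condition T1 T2 z"
    and "level_bound_condition T1 T2 z" "phi_bound_condition T1 T2 z"
    and "tight z f" "f (z 0) = 0"
  shows "radio_labeling G f" "label_span G f = span_bound" "int (radio_number G) = span_bound"
proof -
  show r: "radio_labeling G f"
    using tight_radio_iff[OF assms(1,5)] assms(6) pair_bounds_iff[OF assms(1,2)] assms(3,4) by simp
  show s: "label_span G f = span_bound" using tight_label_span[OF assms(1,2,5)] .
  show "int (radio_number G) = span_bound" using radio_number_eq_span_bound[OF r s] .
qed

text \<open>A labeling that attains the bound is tight along its sorted ordering, so its own
  constraints yield (b) and (c). Conversely, any ordering carries a tight labeling, and the
  conditions make it a radio labeling.\<close>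

lemma radio_number_eq_iff:
  "int (radio_number G) = span_bound \<longleftrightarrow>
    (\<exists>z. feasible_ordering T1 T2 z \<and> end_level_condition T1 T2 z \<and>
       level_bound_condition T1 T2 z \<and> phi_bound_condition T1 T2 z)"
proof
  assume rn: "int (radio_number G) = span_bound"
  obtain f where f: "radio_labeling G f" "label_span G f = span_bound"
    using radio_number_attained rn by metis
  obtain z where z: "ordering z" "cost z = min_cost"
    "\<forall>t < p - 1. f (z (Suc t)) = f (z t) + step_length z t"
    using span_lower_bound(2)[OF f] by blast
  have fz: "feasible_ordering T1 T2 z" "end_level_condition T1 T2 z"
    using cost_eq_min_cost_iff[OF z(1)] z(2) by auto
  have "0 \<le> f (z 0)"
    using radio_labelingD(1)[OF f(1)] ordering_in_V[OF z(1), of 0] four_le_p by simp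
  then have "\<forall>a b. a < b \<and> b < p \<longrightarrow> pair_bound z a b"
    using tight_radio_iff[OF fz(1)] tight_iff[OF fz(1)] z(3) f(1) by blast
  then show "\<exists>z. feasible_ordering T1 T2 z \<and> end_level_condition T1 T2 z \<and>
       level_bound_condition T1 T2 z \<and> phi_bound_condition T1 T2 z"
    using pair_bounds_iff[OF fz] fz by blast
next
  assume "\<exists>z. feasible_ordering T1 T2 z \<and> end_level_condition T1 T2 z \<and>
       level_bound_condition T1 T2 z \<and> phi_bound_condition T1 T2 z"
  then obtain z where z: "feasible_ordering T1 T2 z" "end_level_condition T1 T2 z"
       "level_bound_condition T1 T2 z" "phi_bound_condition T1 T2 z" by blast
  obtain f where "tight z f" "f (z 0) = 0"
    using tight_exists z(1) feasible_ordering_iff by metis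
  then show "int (radio_number G) = span_bound" using tight_optimal(3)[OF z] by blast
qed

end

theorem theorem3p4:
  fixes T1 :: "'a pair_pre_digraph" and T2 :: "'b pair_pre_digraph"
    and G :: "('a \<times> 'b) pair_pre_digraph"
    and m n d1 d2 p d :: nat
  assumes "undirected_tree T1" and "undirected_tree T2"
    and "m = card (pverts T1)" and "n = card (pverts T2)"
    and "d1 = gdiam T1" and "d1 \<ge> 2" and "d2 = gdiam T2" and "d2 \<ge> 2"
    and "G = cart_prod T1 T2" and "p = m * n" and "d = d1 + d2"
  shows
    "(int (radio_number G) =
        (if card (weight_centers T1) = 1 \<and> card (weight_centers T2) = 1
         then (int p - 1) * (int d + 1)
                - 2 * int n * int (total_level T1) - 2 * int m * int (total_level T2) + 1
         else if card (weight_centers T1) * card (weight_centers T2) = 2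
         then (int p - 1) * int d
                - 2 * int n * int (total_level T1) - 2 * int m * int (total_level T2)
         else (int p - 1) * (int d - 1)
                - 2 * int n * int (total_level T1) - 2 * int m * int (total_level T2) + 1)
      \<longleftrightarrow>
      (\<exists>z. feasible_ordering T1 T2 z \<and> end_level_condition T1 T2 z \<and>
           level_bound_condition T1 T2 z \<and> phi_bound_condition T1 T2 z))
     \<and>
     (\<forall>z f. feasible_ordering T1 T2 z \<and> end_level_condition T1 T2 z \<and>
            level_bound_condition T1 T2 z \<and> phi_bound_condition T1 T2 z \<and>
            f (z 0) = 0 \<and>
            (\<forall>i. i + 1 < p \<longrightarrow>
               f (z (i + 1)) = f (z i) + int d + 1
                 - int (prod_level T1 T2 (z i)) - int (prod_level T1 T2 (z (i + 1)))
                 - int (prod_delta T1 T2 (z i) (z (i + 1)))) \<longrightarrow>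
            optimal_radio_labeling G f)"
proof -
  interpret TP: tree_pair T1 T2
    using assms undirected_tree_utree[of T1] undirected_tree_utree[of T2]
    by (simp add: tree_pair_def tree_pair_axioms_def)
  have p: "TP.p = p" unfolding TP.p_def card_cartesian_product using assms by simp
  have bound: "(if card (weight_centers T1) = 1 \<and> card (weight_centers T2) = 1
         then (int p - 1) * (int d + 1)
                - 2 * int n * int (total_level T1) - 2 * int m * int (total_level T2) + 1
         else if card (weight_centers T1) * card (weight_centers T2) = 2
         then (int p - 1) * int d
                - 2 * int n * int (total_level T1) - 2 * int m * int (total_level T2)
         else (int p - 1) * (int d - 1)
                - 2 * int n * int (total_level T1) - 2 * int m * int (total_level T2) + 1)
      = TP.span_bound"
  proof (cases rule: TP.centers_cases)
    case one
    then show ?thesis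
      using assms by (simp add: TP.span_bound_def TP.min_cost_def p)
  next
    case two
    have "\<not> (card (weight_centers T1) = 1 \<and> card (weight_centers T2) = 1)"
      using two(1) by (intro notI) simp
    then show ?thesis
      using two assms by (simp only: if_False if_True TP.span_bound_def TP.min_cost_def p) simp
  next
    case four
    then show ?thesis
      using assms by (simp add: TP.span_bound_def TP.min_cost_def p)
  qed
  have tight: "TP.tight z f" if "\<forall>i. i + 1 < p \<longrightarrow>
               f (z (i + 1)) = f (z i) + int d + 1
                 - int (prod_level T1 T2 (z i)) - int (prod_level T1 T2 (z (i + 1)))
                 - int (prod_delta T1 T2 (z i) (z (i + 1)))" for z f
    unfolding TP.tight_def p using that assms(5,7,11) by simp
  show ?thesis
    unfolding bound optimal_radio_labeling_def assms(9) TP.radio_number_eq_iff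
  proof (intro conjI allI impI refl; elim conjE)
    fix z f
    assume z: "feasible_ordering T1 T2 z" "end_level_condition T1 T2 z"
      "level_bound_condition T1 T2 z" "phi_bound_condition T1 T2 z" and f0: "f (z 0) = 0"
      and "\<forall>i. i + 1 < p \<longrightarrow>
               f (z (i + 1)) = f (z i) + int d + 1
                 - int (prod_level T1 T2 (z i)) - int (prod_level T1 T2 (z (i + 1)))
                 - int (prod_delta T1 T2 (z i) (z (i + 1)))"
    note opt = TP.tight_optimal[OF z, where f = f, OF tight f0]
    show "radio_labeling (cart_prod T1 T2) f" by (rule opt(1)) fact
    show "label_span (cart_prod T1 T2) f = int (radio_number (cart_prod T1 T2))"
      by (rule trans[OF opt(2) opt(3)[symmetric]]) fact+
  qed
qed

end
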